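(* Let $M$ be a loopfree matroid of rank $r$ on $[n]$. Then in $\mathbb{M}_{r,n}$ $$M=\sum_{T\in\mathcal{C}_{\mathcal{Z}}(M),\,T\ne\hat 1}\bigl(-\mu_{\mathcal{C}_{\mathcal{Z}}(M)}(T,\hat 1)\bigr)\,M\langle T\rangle .$$
   Context: $\mathbb{M}_{r,n}$: for $1\le r\le n$, let $\mathfrak{C}_{r,n}$ be the set of chains $\emptyset\subsetneq F_1\subsetneq\dots\subsetneq F_r=[n]$ and $V_{r,n}=\mathbb{Z}^{\mathfrak{C}_{r,n}}$; each loopfree matroid $M$ of rank $r$ on $[n]$ is identified with $v_M\in V_{r,n}$, $(v_M)_{\mathcal{C}}=1$ if $\mathcal{C}$ is a chain of flats of $M$ and $0$ otherwise; $\mathbb{M}_{r,n}$ is the free $\mathbb{Z}$-module on loopfree rank-$r$ matroids on $[n]$ modulo the kernel of $M\mapsto v_M$. A cyclic flat is a flat that is a union of circuits; $\mathcal{Z}(M)$ is the lattice of cyclic flats (ordered by inclusion), and $1_{\mathcal{Z}}$ its largest element (the union of all circuits). The cyclic chain lattice $\mathcal{C}_{\mathcal{Z}}(M)$ is the set of chains $T\subseteq\mathcal{Z}(M)$ with $\emptyset,1_{\mathcal{Z}}\in T$, ordered by inclusion, together with an artificial maximal element $\hat 1>T$ for all $T$. For $T\ne\hat1$, $M\langle T\rangle$ is the (nested) matroid on $[n]$ whose set of cyclic flats is exactly $T$ and whose rank on each $Z\in T$ is $\mathrm{rank}_M(Z)$. The Möbius function of a poset $P$ is defined by $\mu_P(x,y)=0$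 if $x\not\le y$, $\mu_P(x,x)=1$, and $\mu_P(x,y)=-\sum_{x\le z<y}\mu_P(x,z)$ for $x<y$. *)

theory Defs
  imports "HOL-Algebra.Free_Abelian_Groups"
begin

section \<open>Matroids\<close>

text \<open>A matroid on a ground set \<open>E\<close> is represented by its family \<open>I\<close> of independent sets.\<close>

locale matroid =
  fixes E :: "'a set" and I :: "'a set set"
  assumes finite_ground: "finite E"
    and indep_subset: "X \<in> I \<Longrightarrow> X \<subseteq> E"
    and indep_empty: "{} \<in> I"
    and indep_hereditary: "X \<in> I \<Longrightarrow> Y \<subseteq> X \<Longrightarrow> Y \<in> I"
    and indep_exchange: "X \<in> I \<Longrightarrow> Y \<in> I \<Longrightarrow> card X < card Y \<Longrightarrow> \<exists>y\<in>Y - X. insert y X \<in> I"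

definition mat_rank :: "'a set set \<Rightarrow> 'a set \<Rightarrow> nat" where
  "mat_rank I A = Max (card ` {X \<in> I. X \<subseteq> A})"

definition loopfree :: "'a set \<Rightarrow> 'a set set \<Rightarrow> bool" where
  "loopfree E I \<longleftrightarrow> (\<forall>e\<in>E. {e} \<in> I)"

definition flats :: "'a set \<Rightarrow> 'a set set \<Rightarrow> 'a set set" where
  "flats E I = {F. F \<subseteq> E \<and> (\<forall>e\<in>E - F. mat_rank I F < mat_rank I (insert e F))}"

definition circuits :: "'a set \<Rightarrow> 'a set set \<Rightarrow> 'a set set" where
  "circuits E I = {C. C \<subseteq> E \<and> C \<notin> I \<and> (\<forall>X. X \<subset> C \<longrightarrow> X \<in> I)}"

definition cyclic_flats :: "'a set \<Rightarrow> 'a set set \<Rightarrow> 'a set set" where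
  "cyclic_flats E I = {F \<in> flats E I. \<exists>\<C> \<subseteq> circuits E I. F = \<Union>\<C>}"

definition top_cyclic_flat :: "'a set \<Rightarrow> 'a set set \<Rightarrow> 'a set" where
  "top_cyclic_flat E I = \<Union>(circuits E I)"

definition nested_matroid :: "'a set \<Rightarrow> 'a set set \<Rightarrow> 'a set set \<Rightarrow> 'a set set" where
  "nested_matroid E I T = (THE J. matroid E J \<and> cyclic_flats E J = T \<and>
     (\<forall>Z\<in>T. mat_rank J Z = mat_rank I Z))"


section \<open>Moebius functions\<close>

text \<open>A poset is given by its order relation \<open>R\<close>, a partial order on \<^term>\<open>Field R\<close>. The guard
  (a partial order all of whose intervals are finite) is what makes the recursion terminate.\<close>

definition locally_finite_poset :: "('a \<times> 'a) set \<Rightarrow> bool" where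
  "locally_finite_poset R \<longleftrightarrow> partial_order_on (Field R) R \<and>
     (\<forall>x y. finite {z. (x, z) \<in> R \<and> (z, y) \<in> R})"

function mobius :: "('a \<times> 'a) set \<Rightarrow> 'a \<Rightarrow> 'a \<Rightarrow> int" where
  "mobius R x y =
     (if locally_finite_poset R then
        (if (x, y) \<notin> R then 0
         else if x = y then 1
         else - (\<Sum>z\<in>{z. (x, z) \<in> R \<and> (z, y) \<in> R \<and> z \<noteq> y}. mobius R x z))
      else undefined)"
  by pat_completeness auto
termination
proof (relation "measure (\<lambda>(R, x, y). card {z. (x, z) \<in> R \<and> (z, y) \<in> R})", simp, clarsimp)
  fix R :: "('a \<times> 'a) set" and x y z
  assume R: "locally_finite_poset R" and xy: "(x, y) \<in> R" and z: "(x, z) \<in> R" "(z, y) \<in> R" "z \<noteq> y"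
  then have "trans R" "antisym R"
    by (auto simp: locally_finite_poset_def partial_order_on_def preorder_on_def)
  with xy z have "{w. (x, w) \<in> R \<and> (w, z) \<in> R} \<subseteq> {w. (x, w) \<in> R \<and> (w, y) \<in> R}"
    and "y \<notin> {w. (x, w) \<in> R \<and> (w, z) \<in> R}"
    by (auto dest: transD antisymD)
  moreover have "y \<in> {w. (x, w) \<in> R \<and> (w, y) \<in> R}"
    using R xy by (auto simp: locally_finite_poset_def partial_order_on_def preorder_on_def
        intro: refl_onD FieldI2)
  ultimately show "card {w. (x, w) \<in> R \<and> (w, z) \<in> R} < card {w. (x, w) \<in> R \<and> (w, y) \<in> R}"
    using R by (intro psubset_card_mono) (auto simp: locally_finite_poset_def)
qed

declare mobius.simps [simp del]


section \<open>The cyclic chain lattice\<close>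

definition cyclic_chains :: "'a set \<Rightarrow> 'a set set \<Rightarrow> 'a set set set" where
  "cyclic_chains E I = {T. T \<subseteq> cyclic_flats E I \<and> chain_subset T \<and>
     {} \<in> T \<and> top_cyclic_flat E I \<in> T}"

text \<open>The artificial maximal element is \<^term>\<open>None\<close>; the chain \<open>T\<close> itself is \<open>Some T\<close>.\<close>

definition cyclic_chain_lattice :: "'a set \<Rightarrow> 'a set set \<Rightarrow> 'a set set option set" where
  "cyclic_chain_lattice E I = insert None (Some ` cyclic_chains E I)"

definition cyclic_chain_order ::
    "'a set \<Rightarrow> 'a set set \<Rightarrow> ('a set set option \<times> 'a set set option) set" where
  "cyclic_chain_order E I = {(S, T) \<in> cyclic_chain_lattice E I \<times> cyclic_chain_lattice E I.
     T = None \<or> (\<exists>A B. S = Some A \<and> T = Some B \<and> A \<subseteq> B)}"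

lemma Field_cyclic_chain_order: "Field (cyclic_chain_order E I) = cyclic_chain_lattice E I"
  by (fastforce simp: Field_def cyclic_chain_order_def cyclic_chain_lattice_def)

lemma locally_finite_cyclic_chain_order:
  assumes "matroid E I"
  shows "locally_finite_poset (cyclic_chain_order E I)"
proof -
  have "partial_order_on (cyclic_chain_lattice E I) (cyclic_chain_order E I)"
    by (auto simp: partial_order_on_def preorder_on_def cyclic_chain_order_def
        cyclic_chain_lattice_def intro!: refl_onI transI antisymI)
  moreover have "cyclic_chains E I \<subseteq> Pow (Pow E)"
    by (auto simp: cyclic_chains_def cyclic_flats_def flats_def)
  then have "finite (cyclic_chain_lattice E I)"
    using matroid.finite_ground[OF assms] unfolding cyclic_chain_lattice_def
    by (meson finite_Pow_iff finite_imageI finite_insert finite_subset)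
  then have "finite {z. (x, z) \<in> cyclic_chain_order E I \<and> (z, y) \<in> cyclic_chain_order E I}" for x y
    by (rule rev_finite_subset) (auto simp: cyclic_chain_order_def)
  ultimately show ?thesis
    by (simp add: locally_finite_poset_def Field_cyclic_chain_order)
qed


section \<open>The module of loopfree matroids of rank r on [n]\<close>

definition loopfree_matroids :: "nat \<Rightarrow> nat \<Rightarrow> nat set set set" where
  "loopfree_matroids r n =
     {M. matroid {1..n} M \<and> loopfree {1..n} M \<and> mat_rank M {1..n} = r}"

definition full_chains :: "nat \<Rightarrow> nat \<Rightarrow> nat set list set" where
  "full_chains r n = {Fs. length Fs = r \<and> sorted_wrt (\<subset>) ({} # Fs) \<and> last Fs = {1..n}}"

definition chain_space :: "nat \<Rightarrow> nat \<Rightarrow> (nat set list \<Rightarrow> int) monoid" where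
  "chain_space r n = product_group (full_chains r n) (\<lambda>_. integer_group)"

definition chain_vector :: "nat \<Rightarrow> nat \<Rightarrow> nat set set \<Rightarrow> nat set list \<Rightarrow> int" where
  "chain_vector r n M = (\<lambda>Fs\<in>full_chains r n. of_bool (set Fs \<subseteq> flats {1..n} M))"

text \<open>The linear extension of \<^term>\<open>chain_vector r n\<close> to formal integer combinations of matroids.\<close>

definition chain_map :: "nat \<Rightarrow> nat \<Rightarrow> (nat set set \<Rightarrow>\<^sub>0 int) \<Rightarrow> nat set list \<Rightarrow> int" where
  "chain_map r n c = (\<lambda>Fs\<in>full_chains r n.
     \<Sum>M\<in>Poly_Mapping.keys c. Poly_Mapping.lookup c M * chain_vector r n M Fs)"

definition chain_kernel :: "nat \<Rightarrow> nat \<Rightarrow> (nat set set \<Rightarrow>\<^sub>0 int) set" where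
  "chain_kernel r n =
     kernel (free_Abelian_group (loopfree_matroids r n)) (chain_space r n) (chain_map r n)"

text \<open>As with all groups of HOL-Algebra, the operation of this abelian group is written
  multiplicatively: sums are finite products, and integer multiples are powers.\<close>

definition matroid_module :: "nat \<Rightarrow> nat \<Rightarrow> (nat set set \<Rightarrow>\<^sub>0 int) set monoid" where
  "matroid_module r n = free_Abelian_group (loopfree_matroids r n) Mod chain_kernel r n"

definition matroid_class :: "nat \<Rightarrow> nat \<Rightarrow> nat set set \<Rightarrow> (nat set set \<Rightarrow>\<^sub>0 int) set" where
  "matroid_class r n M =
     chain_kernel r n #>\<^bsub>free_Abelian_group (loopfree_matroids r n)\<^esub> frag_of M"

lemma chain_map_frag_of:
  "M \<in> loopfree_matroids r n \<Longrightarrow> chain_map r n (frag_of M) = chain_vector r n M"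
  by (auto simp: chain_map_def chain_vector_def)

lemma chain_map_hom:
  "chain_map r n \<in> hom (free_Abelian_group (loopfree_matroids r n)) (chain_space r n)"
proof -
  have lin: "(\<Sum>M\<in>Poly_Mapping.keys (c + d). Poly_Mapping.lookup (c + d) M * f M) =
      (\<Sum>M\<in>Poly_Mapping.keys c. Poly_Mapping.lookup c M * f M) +
      (\<Sum>M\<in>Poly_Mapping.keys d. Poly_Mapping.lookup d M * f M)"
    for c d :: "nat set set \<Rightarrow>\<^sub>0 int" and f :: "nat set set \<Rightarrow> int"
  proof -
    let ?K = "Poly_Mapping.keys c \<union> Poly_Mapping.keys d"
    have *: "(\<Sum>M\<in>Poly_Mapping.keys e. Poly_Mapping.lookup e M * f M) =
        (\<Sum>M\<in>?K. Poly_Mapping.lookup e M * f M)" if "Poly_Mapping.keys e \<subseteq> ?K" for e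
      using that by (intro sum.mono_neutral_left) (auto simp: in_keys_iff)
    show ?thesis
      by (subst (1 2 3) *)
        (auto simp: sum.distrib lookup_add algebra_simps dest: subsetD[OF Poly_Mapping.keys_add])
  qed
  show ?thesis
  proof (rule homI)
    show "chain_map r n c \<in> carrier (chain_space r n)" for c
      by (simp add: chain_space_def chain_map_def)
  qed (simp add: chain_space_def chain_map_def free_Abelian_group_def lin fun_eq_iff)
qed

lemma comm_group_matroid_module: "comm_group (matroid_module r n)"
proof -
  let ?G = "free_Abelian_group (loopfree_matroids r n)"
  interpret group_hom ?G "chain_space r n" "chain_map r n"
    using chain_map_hom[of r n]
    by (simp add: group_hom_def group_hom_axioms_def chain_space_def)
  show ?thesis
    unfolding matroid_module_def chain_kernel_def
    using comm_group.abelian_FactGroup[OF abelian_free_Abelian_group] subgroup_kernel by blast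
qed

end

theory Submission
  imports Defs Complex_Main
begin

text \<open>A chain \<open>{} = F 0 \<subset> \<dots> \<subset> F r = [n]\<close> consists of flats of a loopfree rank-\<open>r\<close> matroid \<open>N\<close> iff
  \<open>x(Z) \<le> rk Z\<close> for every cyclic flat \<open>Z\<close> and, for every \<open>i\<close>, some cyclic flat \<open>Z\<close> satisfies
  \<open>rk Z + |F i - Z| \<le> i\<close>; here \<open>x\<close> has total mass one, spread evenly, on each block
  \<open>F (i + 1) - F i\<close>. Applied to \<open>M\<langle>T\<rangle>\<close>, whose cyclic flats and their ranks are given by \<open>T\<close>, this says
  that \<open>T\<close> avoids a set \<open>V\<close> and meets sets \<open>Q i\<close> of cyclic flats of \<open>M\<close>, where \<open>V\<close> and \<open>Q i\<close> do not
  depend on \<open>T\<close>. By inclusion-exclusion it remains to sum the coefficients over all \<open>T\<close> avoiding a set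
  \<open>W\<close>, the union of \<open>V\<close> and some of the \<open>Q i\<close>. Since \<open>-\<mu>(T, 1)\<close> is the sum of \<open>(-1)^|S - T|\<close> over
  the chains \<open>S \<supseteq> T\<close>, that sum is the negative of the reduced Euler characteristic of the order complex
  of \<open>W\<close>. It is 1 if \<open>W\<close> is empty, and 0 otherwise: supermodularity of \<open>x(Z) - rk Z\<close> makes \<open>W\<close>
  conically contractible.\<close>

section \<open>Alternating sums over chains of sets\<close>

text \<open>The sum is the negative of the reduced Euler characteristic of the order complex of \<open>V\<close>. It
  vanishes because \<open>V\<close> is conically contractible: \<open>Z \<ge> Z \<and> m \<le> m\<close>, with meets taken in \<open>V\<close>. The
  sign-reversing involution toggles \<open>Z \<and> m\<close> for the least \<open>Z\<close> of the chain not below \<open>m\<close>, or \<open>m\<close>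
  itself if there is no such \<open>Z\<close>.\<close>

lemma conic_chain_sum:
  fixes V :: "'a set set"
  assumes fin: "finite V" and m: "m \<in> V"
    and K: "\<And>Z. Z \<in> V \<Longrightarrow> \<exists>K\<in>V. K \<subseteq> Z \<and> K \<subseteq> m \<and> (\<forall>Y\<in>V. Y \<subseteq> Z \<longrightarrow> Y \<subseteq> m \<longrightarrow> Y \<subseteq> K)"
  shows "(\<Sum>S | S \<subseteq> V \<and> chain_subset S. (-1) ^ card S) = (0::int)"
proof -
  obtain k where k: "\<And>Z. Z \<in> V \<Longrightarrow> k Z \<in> V" "\<And>Z. Z \<in> V \<Longrightarrow> k Z \<subseteq> Z" "\<And>Z. Z \<in> V \<Longrightarrow> k Z \<subseteq> m"
    "\<And>Z Y. Z \<in> V \<Longrightarrow> Y \<in> V \<Longrightarrow> Y \<subseteq> Z \<Longrightarrow> Y \<subseteq> m \<Longrightarrow> Y \<subseteq> k Z"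
    using K by metis
  define N where "N S = {Z \<in> S. \<not> Z \<subseteq> m}" for S
  define t where "t S = (if N S = {} then m else k (\<Inter> (N S)))" for S
  define \<phi> where "\<phi> S = (if t S \<in> S then S - {t S} else insert (t S) S)" for S
  let ?\<C> = "{S. S \<subseteq> V \<and> chain_subset S}"
  \<comment> \<open>The members of \<open>S\<close> not below \<open>m\<close> form a finite chain,
    so their intersection is the least of them.\<close>
  have least: "\<Inter> (N S) \<in> N S" if "S \<in> ?\<C>" "N S \<noteq> {}" for S
  proof (rule Inter_in_chain)
    show "finite (N S)" using that fin by (auto simp: N_def intro: finite_subset)
    show "subset.chain UNIV (N S)" using that by (auto simp: subset.chain_def N_def chain_subset_def)
  qed (use that in auto)
  have t: "t S \<in> V" "t S \<subseteq> m" if S: "S \<in> ?\<C>" for S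
  proof -
    have "\<Inter> (N S) \<in> V" if "N S \<noteq> {}"
      using least[OF S that] S by (auto simp: N_def)
    then show "t S \<in> V" "t S \<subseteq> m" using m k(1,3) by (simp_all add: t_def)
  qed
  \<comment> \<open>The toggled set lies below \<open>m\<close>, so toggling leaves
    \<open>N S\<close>, and with it \<open>t S\<close>, unchanged; this makes \<open>\<phi>\<close>
    an involution.\<close>
  have N\<phi>: "N (\<phi> S) = N S" if "S \<in> ?\<C>" for S
    using t(2)[OF that] by (auto simp: \<phi>_def N_def)
  have t\<phi>: "t (\<phi> S) = t S" if "S \<in> ?\<C>" for S
    using N\<phi>[OF that] by (simp add: t_def)
  \<comment> \<open>Toggling preserves chains. If \<open>N S\<close> is empty, all members lie below
    \<open>t S = m\<close>. Otherwise members below \<open>m\<close> lie below the least member of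
    \<open>N S\<close> and so below its meet with \<open>m\<close>, and all other members contain
    that meet.\<close>
  have comp: "Y \<subseteq> t S \<or> t S \<subseteq> Y" if S: "S \<in> ?\<C>" and Y: "Y \<in> S" for S Y
  proof (cases "N S = {}")
    case True
    then show ?thesis using Y by (auto simp: t_def N_def)
  next
    case False
    let ?Z = "\<Inter> (N S)"
    have Z: "?Z \<in> S" using least[OF S False] by (auto simp: N_def)
    have ZV: "?Z \<in> V" "Y \<in> V" using Z S Y by auto
    show ?thesis
    proof (cases "Y \<subseteq> m")
      case Y': True
      have "\<not> ?Z \<subseteq> Y" using least[OF S False] Y' by (auto simp: N_def)
      then have "Y \<subseteq> ?Z" using S Y Z unfolding chain_subset_def by blast
      then show ?thesis using k(4)[OF ZV _ Y'] False by (simp add: t_def)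
    next
      case Y': False
      then have "?Z \<subseteq> Y" using Y by (auto simp: N_def)
      then show ?thesis using k(2)[OF ZV(1)] False by (auto simp: t_def)
    qed
  qed
  have \<phi>C: "\<phi> S \<in> ?\<C>" if S: "S \<in> ?\<C>" for S
    using S t(1)[OF S] comp[OF S] unfolding \<phi>_def chain_subset_def by auto
  have inv: "\<phi> (\<phi> S) = S" if S: "S \<in> ?\<C>" for S
    using t\<phi>[OF S] by (auto simp: \<phi>_def)
  have "(-1) ^ card (\<phi> S) = - ((-1::int) ^ card S)" if S: "S \<in> ?\<C>" for S
  proof -
    have "finite S" using S fin by (auto intro: finite_subset)
    show ?thesis
    proof (cases "t S \<in> S")
      case True
      then have "card S = Suc (card (\<phi> S))"
        using \<open>finite S\<close> by (simp only: \<phi>_def if_True card.remove)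
      then show ?thesis by simp
    next
      case False
      then show ?thesis using \<open>finite S\<close> by (simp add: \<phi>_def)
    qed
  qed
  then have "(\<Sum>S\<in>?\<C>. (-1) ^ card S) = (\<Sum>S\<in>?\<C>. - ((-1::int) ^ card S))"
    by (intro sum.reindex_bij_witness[where i = \<phi> and j = \<phi>]) (use inv \<phi>C in auto)
  then show ?thesis by (simp add: sum_negf)
qed

text \<open>Toggling a fixed element of \<open>B - A\<close> reverses the sign. The exponent counts
  a complement in \<open>C\<close> because \<open>T\<close> will vary below a chain \<open>S\<close>
  with weight \<open>(-1) ^ card (S - T)\<close>.\<close>

lemma sum_alternating_interval:
  fixes A B C :: "'a set"
  assumes "finite C" "A \<subseteq> B" "B \<subseteq> C"
  shows "(\<Sum>T | A \<subseteq> T \<and> T \<subseteq> B. (-1) ^ card (C - T)) = (if A = B then (-1) ^ card (C - A) else (0::int))"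
proof (cases "A = B")
  case True
  then have "{T. A \<subseteq> T \<and> T \<subseteq> B} = {A}" by auto
  then show ?thesis using True by simp
next
  case False
  then obtain b where b: "b \<in> B" "b \<notin> A" using assms by auto
  define \<phi> where "\<phi> T = (if b \<in> T then T - {b} else insert b T)" for T
  let ?I = "{T. A \<subseteq> T \<and> T \<subseteq> B}"
  have "(-1) ^ card (C - \<phi> T) = - ((-1::int) ^ card (C - T))" if "T \<in> ?I" for T
  proof (cases "b \<in> T")
    case True
    then have "C - \<phi> T = insert b (C - T)" "b \<notin> C - T" using b assms by (auto simp: \<phi>_def)
    then show ?thesis using assms by simp
  next
    case False
    then have "C - T = insert b (C - \<phi> T)" "b \<notin> C - \<phi> T" using b assms by (auto simp: \<phi>_def)
    then show ?thesis using assms by simp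
  qed
  then have "(\<Sum>T\<in>?I. (-1) ^ card (C - T)) = (\<Sum>T\<in>?I. - ((-1::int) ^ card (C - T)))"
    by (intro sum.reindex_bij_witness[where i = \<phi> and j = \<phi>]) (use b in \<open>auto simp: \<phi>_def\<close>)
  then show ?thesis using False by (simp add: sum_negf)
qed

section \<open>Coefficient sums over chains with fixed ends\<close>

lemma chain_subset_mono: "chain_subset S \<Longrightarrow> T \<subseteq> S \<Longrightarrow> chain_subset T"
  by (auto simp: chain_subset_def)

text \<open>For the lattice of cyclic flats with its least and largest element, this is the cyclic
  chain lattice without its artificial top.\<close>

definition bounded_chains :: "'a set set \<Rightarrow> 'a set \<Rightarrow> 'a set \<Rightarrow> 'a set set set" where
  "bounded_chains L a b = {T. T \<subseteq> L \<and> chain_subset T \<and> a \<in> T \<and> b \<in> T}"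

text \<open>Minus the Moebius function from \<open>T\<close> to the artificial top, by
  \<open>mobius_cyclic_chain_order\<close>; each summand is the Moebius value of the Boolean
  interval from \<open>T\<close> to \<open>S\<close>.\<close>

definition chain_coeff :: "'a set set \<Rightarrow> 'a set \<Rightarrow> 'a set \<Rightarrow> 'a set set \<Rightarrow> int" where
  "chain_coeff L a b T = (\<Sum>S | S \<in> bounded_chains L a b \<and> T \<subseteq> S. (-1) ^ card (S - T))"

lemma finite_bounded_chains: "finite L \<Longrightarrow> finite (bounded_chains L a b)"
  by (rule finite_subset[of _ "Pow L"]) (auto simp: bounded_chains_def)

text \<open>Exchange the sums over \<open>T\<close> and \<open>S\<close>. For fixed
  \<open>S\<close>, the sets \<open>T\<close> fill the Boolean interval from \<open>{a, b}\<close>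
  to \<open>S - V\<close>, so only those \<open>S\<close> survive that consist of \<open>a\<close>,
  \<open>b\<close> and a chain in \<open>V\<close>.\<close>

lemma sum_chain_coeff_avoiding:
  assumes fin: "finite L" and ab: "a \<in> L" "b \<in> L" and bd: "\<And>Z. Z \<in> L \<Longrightarrow> a \<subseteq> Z \<and> Z \<subseteq> b"
    and V: "V \<subseteq> L" "a \<notin> V" "b \<notin> V"
  shows "(\<Sum>T | T \<in> bounded_chains L a b \<and> T \<inter> V = {}. chain_coeff L a b T)
    = (\<Sum>S | S \<subseteq> V \<and> chain_subset S. (-1) ^ card S)"
proof -
  let ?B = "bounded_chains L a b"
  note finB = finite_bounded_chains[OF fin, of a b]
  have "(\<Sum>T | T \<in> ?B \<and> T \<inter> V = {}. chain_coeff L a b T)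
    = (\<Sum>S\<in>?B. \<Sum>T | {a, b} \<subseteq> T \<and> T \<subseteq> S - V. (-1) ^ card (S - T))"
  proof -
    have "(\<Sum>T | T \<in> ?B \<and> T \<inter> V = {}. chain_coeff L a b T)
      = (\<Sum>T\<in>{T \<in> ?B. T \<inter> V = {}}. \<Sum>S\<in>{S \<in> ?B. T \<subseteq> S}. (-1) ^ card (S - T))"
      by (simp add: chain_coeff_def)
    also have "\<dots> = (\<Sum>S\<in>?B. \<Sum>T\<in>{T \<in> {T \<in> ?B. T \<inter> V = {}}. T \<subseteq> S}. (-1) ^ card (S - T))"
      by (rule sum.swap_restrict) (use finB in auto)
    also have "\<dots> = (\<Sum>S\<in>?B. \<Sum>T | {a, b} \<subseteq> T \<and> T \<subseteq> S - V. (-1) ^ card (S - T))"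
    proof (rule sum.cong[OF refl])
      fix S assume S: "S \<in> ?B"
      have "{T \<in> {T \<in> ?B. T \<inter> V = {}}. T \<subseteq> S} = {T. {a, b} \<subseteq> T \<and> T \<subseteq> S - V}"
        using S by (auto simp: bounded_chains_def dest: chain_subset_mono)
      then show "(\<Sum>T\<in>{T \<in> {T \<in> ?B. T \<inter> V = {}}. T \<subseteq> S}. (-1::int) ^ card (S - T))
        = (\<Sum>T | {a, b} \<subseteq> T \<and> T \<subseteq> S - V. (-1) ^ card (S - T))" by simp
    qed
    finally show ?thesis .
  qed
  also have "\<dots> = (\<Sum>S\<in>?B. if {a, b} = S - V then (-1) ^ card (S - {a, b}) else 0)"
    using V finite_subset[OF _ fin]
    by (intro sum.cong refl sum_alternating_interval) (auto simp: bounded_chains_def)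
  also have "\<dots> = (\<Sum>S\<in>{S \<in> ?B. {a, b} = S - V}. (-1) ^ card (S - {a, b}))"
    using finB by (simp add: sum.If_cases Int_def)
  also have "\<dots> = (\<Sum>S | S \<subseteq> V \<and> chain_subset S. (-1) ^ card S)"
  proof (rule sum.reindex_bij_witness[where i = "\<lambda>S. S \<union> {a, b}" and j = "\<lambda>S. S - {a, b}"])
    fix S assume "S \<in> {S. S \<subseteq> V \<and> chain_subset S}"
    then have S: "S \<subseteq> V" "chain_subset S" by auto
    have "chain_subset (S \<union> {a, b})"
      unfolding chain_subset_def
    proof (intro ballI)
      fix A B assume AB: "A \<in> S \<union> {a, b}" "B \<in> S \<union> {a, b}"
      then have "A \<in> L" "B \<in> L" using S V ab by auto
      with bd have "a \<subseteq> A" "A \<subseteq> b" "a \<subseteq> B" "B \<subseteq> b" by auto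
      then show "A \<subseteq> B \<or> B \<subseteq> A" using S(2)[unfolded chain_subset_def] AB by blast
    qed
    then show "S \<union> {a, b} \<in> {S \<in> ?B. {a, b} = S - V}"
      using V ab S by (auto simp: bounded_chains_def)
  next
    fix S assume "S \<in> {S \<in> ?B. {a, b} = S - V}"
    then show "S - {a, b} \<in> {S. S \<subseteq> V \<and> chain_subset S}"
      by (auto simp: bounded_chains_def intro: chain_subset_mono)
  qed (use V in \<open>auto simp: bounded_chains_def\<close>)
  finally show ?thesis .
qed

lemma sum_chain_coeff_avoiding_conic:
  assumes fin: "finite L" and ab: "a \<in> L" "b \<in> L" and bd: "\<And>Z. Z \<in> L \<Longrightarrow> a \<subseteq> Z \<and> Z \<subseteq> b"
    and V: "V \<subseteq> L"
    and conic: "V \<noteq> {} \<Longrightarrow> \<exists>m\<in>V. \<forall>Z\<in>V. \<exists>K\<in>V. K \<subseteq> Z \<and> K \<subseteq> m \<and> (\<forall>Y\<in>V. Y \<subseteq> Z \<longrightarrow> Y \<subseteq> m \<longrightarrow> Y \<subseteq> K)"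
  shows "(\<Sum>T | T \<in> bounded_chains L a b \<and> T \<inter> V = {}. chain_coeff L a b T) = of_bool (V = {})"
proof (cases "a \<in> V \<or> b \<in> V")
  case True
  then have "{T. T \<in> bounded_chains L a b \<and> T \<inter> V = {}} = {}" by (auto simp: bounded_chains_def)
  \<comment> \<open>Every bounded chain contains both ends, so none avoids \<open>V\<close>, and
    \<open>V\<close> is not empty.\<close>
  then show ?thesis using True by (simp only: sum.empty) auto
next
  case False
  have eq: "(\<Sum>T | T \<in> bounded_chains L a b \<and> T \<inter> V = {}. chain_coeff L a b T)
    = (\<Sum>S | S \<subseteq> V \<and> chain_subset S. (-1) ^ card S)"
    by (rule sum_chain_coeff_avoiding) (use False fin ab bd V in auto)
  show ?thesis
  proof (cases "V = {}")
    case True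
    have "{S. S \<subseteq> {} \<and> chain_subset S} = {{} :: 'a set set}" by (auto simp: chain_subset_def)
    with True show ?thesis using eq by simp
  next
    case False
    from conic[OF False] obtain m where m: "m \<in> V"
      "\<And>Z. Z \<in> V \<Longrightarrow> \<exists>K\<in>V. K \<subseteq> Z \<and> K \<subseteq> m \<and> (\<forall>Y\<in>V. Y \<subseteq> Z \<longrightarrow> Y \<subseteq> m \<longrightarrow> Y \<subseteq> K)" by blast
    from conic_chain_sum[OF finite_subset[OF V fin] m] False eq show ?thesis by simp
  qed
qed

text \<open>Inclusion-exclusion by induction on \<open>J\<close>: the sets avoiding \<open>V\<close>
  and meeting \<open>Q i\<close> are those avoiding \<open>V\<close> without those avoiding
  \<open>V \<union> Q i\<close>. Hence \<open>V\<close> has to vary in the induction.\<close>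

lemma sum_avoiding_and_meeting:
  fixes c :: "'b set \<Rightarrow> int" and Q :: "'i \<Rightarrow> 'b set"
  assumes "finite B" "finite J"
    and "\<And>J'. J' \<subseteq> J \<Longrightarrow> (\<Sum>T | T \<in> B \<and> T \<inter> (V \<union> (\<Union>j\<in>J'. Q j)) = {}. c T) = of_bool (V \<union> (\<Union>j\<in>J'. Q j) = {})"
  shows "(\<Sum>T | T \<in> B \<and> T \<inter> V = {} \<and> (\<forall>j\<in>J. T \<inter> Q j \<noteq> {}). c T)
    = of_bool (V = {} \<and> (\<forall>j\<in>J. Q j \<noteq> {}))"
  using assms(2,3)
proof (induction J arbitrary: V rule: finite_induct)
  case empty
  from empty[of "{}"] show ?case by simp
next
  case (insert i J)
  let ?A = "\<lambda>V. {T. T \<in> B \<and> T \<inter> V = {} \<and> (\<forall>j\<in>J. T \<inter> Q j \<noteq> {})}"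
  have 1: "(\<Sum>T\<in>?A V. c T) = of_bool (V = {} \<and> (\<forall>j\<in>J. Q j \<noteq> {}))"
    by (rule insert.IH, rule insert.prems) auto
  have 2: "(\<Sum>T\<in>?A (V \<union> Q i). c T) = of_bool (V \<union> Q i = {} \<and> (\<forall>j\<in>J. Q j \<noteq> {}))"
  proof (rule insert.IH)
    fix J' assume "J' \<subseteq> J"
    then show "(\<Sum>T | T \<in> B \<and> T \<inter> (V \<union> Q i \<union> (\<Union>j\<in>J'. Q j)) = {}. c T) = of_bool (V \<union> Q i \<union> (\<Union>j\<in>J'. Q j) = {})"
      using insert.prems[of "insert i J'", OF insert_mono[OF \<open>J' \<subseteq> J\<close>]]
      by (simp only: Un_assoc UN_insert)
  qed
  have split: "{T. T \<in> B \<and> T \<inter> V = {} \<and> (\<forall>j\<in>insert i J. T \<inter> Q j \<noteq> {})} = ?A V - ?A (V \<union> Q i)"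
    by auto
  have "sum c (?A V - ?A (V \<union> Q i)) = sum c (?A V) - sum c (?A (V \<union> Q i))"
    using assms(1) by (intro sum_diff) auto
  also have "\<dots> = of_bool (V = {} \<and> (\<forall>j\<in>insert i J. Q j \<noteq> {}))"
    unfolding 1 2 by (cases "V = {}"; cases "Q i = {}") simp_all
  finally show ?case unfolding split .
qed

section \<open>The Moebius function of the cyclic chain lattice\<close>

lemma mobius_cyclic_chain_order:
  assumes M: "matroid E I" and T: "T \<in> cyclic_chains E I"
  shows "- mobius (cyclic_chain_order E I) (Some T) None
    = chain_coeff (cyclic_flats E I) {} (top_cyclic_flat E I) T"
proof -
  let ?R = "cyclic_chain_order E I"
  note lf = locally_finite_cyclic_chain_order[OF M]
  have fE: "finite E" using M by (simp add: matroid_def)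
  have finL: "finite (cyclic_flats E I)"
    by (rule finite_subset[of _ "Pow E"]) (auto simp: cyclic_flats_def flats_def fE)
  have chains: "cyclic_chains E I = bounded_chains (cyclic_flats E I) {} (top_cyclic_flat E I)"
    by (simp add: cyclic_chains_def bounded_chains_def)
  \<comment> \<open>Subsets of a chain are chains, and \<open>T\<close> already contains both ends;
    hence all intervals above \<open>T\<close> and below the artificial top are Boolean.\<close>
  have between: "U \<in> cyclic_chains E I" if "S \<in> cyclic_chains E I" "T \<subseteq> U" "U \<subseteq> S" for S U
    using that T by (auto simp: cyclic_chains_def dest: chain_subset_mono)
  have ord: "(Some A, Some B) \<in> ?R \<longleftrightarrow> A \<in> cyclic_chains E I \<and> B \<in> cyclic_chains E I \<and> A \<subseteq> B"
    "(Some A, None) \<in> ?R \<longleftrightarrow> A \<in> cyclic_chains E I" "(None, Some B) \<notin> ?R" for A B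
    by (auto simp: cyclic_chain_order_def cyclic_chain_lattice_def)
  have SS: "mobius ?R (Some T) (Some S) = (-1) ^ card (S - T)"
    if "S \<in> cyclic_chains E I" "T \<subseteq> S" for S
    using that
  proof (induction "card S" arbitrary: S rule: less_induct)
    case less
    have finS: "finite S" using less.prems finL by (auto simp: cyclic_chains_def intro: finite_subset)
    show ?case
    proof (cases "T = S")
      case True
      then show ?thesis using T lf by (subst mobius.simps) (simp add: ord)
    next
      case False
      have set: "{z. (Some T, z) \<in> ?R \<and> (z, Some S) \<in> ?R \<and> z \<noteq> Some S} = Some ` {U. T \<subseteq> U \<and> U \<subset> S}"
        (is "?l = ?r")
      proof (rule Set.set_eqI)
        show "z \<in> ?l \<longleftrightarrow> z \<in> ?r" for z
          by (cases z) (use T less.prems in \<open>auto simp: ord intro: between\<close>)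
      qed
      have "mobius ?R (Some T) (Some S) = - (\<Sum>U\<in>{U. T \<subseteq> U \<and> U \<subset> S}. mobius ?R (Some T) (Some U))"
      proof -
        have "mobius ?R (Some T) (Some S)
          = - (\<Sum>z\<in>{z. (Some T, z) \<in> ?R \<and> (z, Some S) \<in> ?R \<and> z \<noteq> Some S}. mobius ?R (Some T) z)"
          using False T less.prems lf by (subst mobius.simps) (simp add: ord)
        then show ?thesis unfolding set by (simp add: sum.reindex)
      qed
      also have "\<dots> = - (\<Sum>U\<in>{U. T \<subseteq> U \<and> U \<subset> S}. (-1) ^ card (U - T))"
        using less.prems between finS
        by (intro arg_cong[where f = uminus] sum.cong refl less.hyps) (auto intro: psubset_card_mono)
      \<comment> \<open>Adding the missing term \<open>U = S\<close> completes the Boolean interval,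
        whose alternating sum is zero.\<close>
      also have "(\<Sum>U\<in>{U. T \<subseteq> U \<and> U \<subset> S}. (-1) ^ card (U - T)) = (\<Sum>U\<in>{U. T \<subseteq> U \<and> U \<subseteq> S}. (-1::int) ^ card (U - T)) - (-1) ^ card (S - T)"
      proof -
        have "{U. T \<subseteq> U \<and> U \<subseteq> S} = insert S {U. T \<subseteq> U \<and> U \<subset> S}" using less.prems by auto
        moreover have "finite {U. T \<subseteq> U \<and> U \<subset> S}"
          by (rule finite_subset[of _ "Pow S"]) (use finS in auto)
        ultimately show ?thesis by simp
      qed
      \<comment> \<open>Passing from \<open>U - T\<close> to the complement \<open>S - U\<close>
        costs the constant sign \<open>(-1) ^ card (S - T)\<close>.\<close>
      also have "(\<Sum>U\<in>{U. T \<subseteq> U \<and> U \<subseteq> S}. (-1::int) ^ card (U - T))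
        = (\<Sum>U | T \<subseteq> U \<and> U \<subseteq> S. (-1) ^ card (S - T) * (-1) ^ card (S - U))"
      proof (rule sum.cong[OF refl])
        fix U assume "U \<in> {U. T \<subseteq> U \<and> U \<subseteq> S}"
        then have "S - T = (S - U) \<union> (U - T)" "(S - U) \<inter> (U - T) = {}" "finite U"
          using finS finite_subset by auto
        then have "card (S - T) = card (S - U) + card (U - T)"
          using finS by (metis card_Un_disjoint finite_Diff)
        then show "(-1::int) ^ card (U - T) = (-1) ^ card (S - T) * (-1) ^ card (S - U)"
          by (simp add: power_add)
      qed
      also have "\<dots> = 0"
        using sum_alternating_interval[of S T S] False less.prems finS
        by (simp flip: sum_distrib_left)
      finally show ?thesis by simp
    qed
  qed
  have set: "{z. (Some T, z) \<in> ?R \<and> (z, None) \<in> ?R \<and> z \<noteq> None} = Some ` {S. S \<in> cyclic_chains E I \<and> T \<subseteq> S}"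
    (is "?l = ?r")
  proof (rule Set.set_eqI)
    show "z \<in> ?l \<longleftrightarrow> z \<in> ?r" for z
      by (cases z) (use T in \<open>auto simp: ord\<close>)
  qed
  have "mobius ?R (Some T) None = - (\<Sum>S | S \<in> cyclic_chains E I \<and> T \<subseteq> S. mobius ?R (Some T) (Some S))"
  proof -
    have "mobius ?R (Some T) None
      = - (\<Sum>z\<in>{z. (Some T, z) \<in> ?R \<and> (z, None) \<in> ?R \<and> z \<noteq> None}. mobius ?R (Some T) z)"
      using T lf by (subst mobius.simps) (simp add: ord)
    then show ?thesis unfolding set by (simp add: sum.reindex)
  qed
  also have "\<dots> = - (\<Sum>S | S \<in> cyclic_chains E I \<and> T \<subseteq> S. (-1) ^ card (S - T))"
    by (intro arg_cong[where f = uminus] sum.cong refl) (simp add: SS)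
  finally show ?thesis by (simp add: chain_coeff_def chains)
qed

section \<open>Rank, closure and cyclic flats\<close>

context matroid
begin

section \<open>The rank function\<close>

abbreviation rk :: "'a set \<Rightarrow> nat" where "rk \<equiv> mat_rank I"

lemma finite_subset_ground: "A \<subseteq> E \<Longrightarrow> finite A"
  using finite_ground finite_subset by blast

lemma finite_indep: "X \<in> I \<Longrightarrow> finite X"
  using indep_subset finite_subset_ground by blast

lemma finite_indep_cards: "finite (card ` {X \<in> I. X \<subseteq> A})"
proof -
  have "{X \<in> I. X \<subseteq> A} \<subseteq> Pow E" using indep_subset by auto
  then show ?thesis using finite_ground by (meson finite_Pow_iff finite_imageI finite_subset)
qed

lemma card_le_rank: "X \<in> I \<Longrightarrow> X \<subseteq> A \<Longrightarrow> card X \<le> rk A"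
  unfolding mat_rank_def by (rule Max_ge[OF finite_indep_cards]) auto

lemma obtain_basis:
  obtains X where "X \<in> I" "X \<subseteq> A" "card X = rk A"
proof -
  have "card ` {X \<in> I. X \<subseteq> A} \<noteq> {}" using indep_empty by auto
  from Max_in[OF finite_indep_cards this] show ?thesis
    using that unfolding mat_rank_def by auto
qed

lemma rank_le:
  assumes "\<And>X. X \<in> I \<Longrightarrow> X \<subseteq> A \<Longrightarrow> card X \<le> k"
  shows "rk A \<le> k"
  by (rule obtain_basis[of A]) (use assms in force)

lemma rank_mono: "A \<subseteq> B \<Longrightarrow> rk A \<le> rk B"
  by (rule rank_le) (auto intro: card_le_rank)

lemma rank_empty [simp]: "rk {} = 0"
  by (rule obtain_basis[of "{}"]) auto

lemma indep_iff_rank: "A \<subseteq> E \<Longrightarrow> A \<in> I \<longleftrightarrow> rk A = card A"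
proof
  assume "A \<subseteq> E" "A \<in> I"
  then show "rk A = card A"
    using card_le_rank[of A A] rank_le[of A "card A"] finite_subset_ground card_mono
    by (metis order_antisym order_refl)
next
  assume "A \<subseteq> E" "rk A = card A"
  then show "A \<in> I"
    using finite_subset_ground card_subset_eq by (metis obtain_basis[of A])
qed

lemma extend_to_basis:
  assumes X: "X \<in> I" "X \<subseteq> A"
  obtains Y where "Y \<in> I" "X \<subseteq> Y" "Y \<subseteq> A" "card Y = rk A"
proof -
  have "\<exists>Y. Y \<in> I \<and> X \<subseteq> Y \<and> Y \<subseteq> A \<and> card Y = rk A"
    using X
  proof (induction "rk A - card X" arbitrary: X rule: less_induct)
    case less
    show ?case
    proof (cases "card X = rk A")
      case True
      then show ?thesis using less.prems by auto
    next
      case False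
      then have lt: "card X < rk A" using card_le_rank[OF less.prems] by simp
      obtain B where B: "B \<in> I" "B \<subseteq> A" "card B = rk A" by (rule obtain_basis)
      with lt indep_exchange[OF less.prems(1) B(1)] obtain y where y: "y \<in> B - X" "insert y X \<in> I"
        by auto
      have "card (insert y X) = Suc (card X)" using y finite_indep[OF less.prems(1)] by simp
      then have "\<exists>Y. Y \<in> I \<and> insert y X \<subseteq> Y \<and> Y \<subseteq> A \<and> card Y = rk A"
        using lt y B less.prems by (intro less.hyps) auto
      then show ?thesis by auto
    qed
  qed
  then show ?thesis using that by blast
qed

text \<open>Extend a basis \<open>X\<close> of \<open>A \<inter> B\<close> to a basis
  \<open>Y\<close> of \<open>A \<union> B\<close>; the traces of \<open>Y\<close> on
  \<open>A\<close> and on \<open>B\<close> are independent, and they share at least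
  \<open>X\<close>.\<close>

lemma rank_submodular: "rk (A \<union> B) + rk (A \<inter> B) \<le> rk A + rk B"
proof -
  obtain X where X: "X \<in> I" "X \<subseteq> A \<inter> B" "card X = rk (A \<inter> B)" by (rule obtain_basis)
  obtain Y where Y: "Y \<in> I" "X \<subseteq> Y" "Y \<subseteq> A \<union> B" "card Y = rk (A \<union> B)"
    using extend_to_basis[of X "A \<union> B"] X by blast
  have fin: "finite Y" using Y finite_indep by blast
  have "card (Y \<inter> A) \<le> rk A" "card (Y \<inter> B) \<le> rk B"
    using Y by (auto intro!: card_le_rank indep_hereditary[OF Y(1)])
  moreover have "card (Y \<inter> A) + card (Y \<inter> B) = card Y + card (Y \<inter> A \<inter> B)"
  proof -
    have "Y = (Y \<inter> A) \<union> (Y \<inter> B)" "Y \<inter> A \<inter> B = (Y \<inter> A) \<inter> (Y \<inter> B)" using Y by auto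
    then show ?thesis using card_Un_Int[of "Y \<inter> A" "Y \<inter> B"] fin by simp
  qed
  moreover have "card X \<le> card (Y \<inter> A \<inter> B)" using X Y fin by (intro card_mono) auto
  ultimately show ?thesis using X Y by linarith
qed

lemma rank_le_card: "finite A \<Longrightarrow> rk A \<le> card A"
  by (rule rank_le) (rule card_mono)

lemma rank_Un_le: "rk (A \<union> B) \<le> rk A + rk B"
  using rank_submodular[of A B] by simp

text \<open>Every \<open>Z\<close> bounds the rank of \<open>A\<close> in this way; by
  \<open>obtain_cyclic_flat\<close> some cyclic flat attains the bound.\<close>

lemma rank_le_add_card_Diff:
  assumes "A \<subseteq> E"
  shows "rk A \<le> rk Z + card (A - Z)"
proof -
  have "rk A \<le> rk (Z \<union> (A - Z))" by (rule rank_mono) auto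
  also have "\<dots> \<le> rk Z + rk (A - Z)" by (rule rank_Un_le)
  also have "rk (A - Z) \<le> card (A - Z)"
    using assms finite_subset_ground by (intro rank_le_card) auto
  finally show ?thesis by simp
qed

lemma rank_insert_le: "e \<in> E \<Longrightarrow> rk (insert e A) \<le> Suc (rk A)"
proof -
  have "rk (A \<union> {e}) \<le> rk A + rk {e}" by (rule rank_Un_le)
  also have "rk {e} \<le> 1" using rank_le_card[of "{e}"] by simp
  finally show ?thesis by simp
qed

text \<open>Submodularity for \<open>insert e A\<close> and \<open>B\<close>, which meet in
  \<open>A\<close> when \<open>e\<close> is not in \<open>B\<close>.\<close>

lemma rank_insert_mono:
  assumes "rk (insert e A) = rk A" "A \<subseteq> B"
  shows "rk (insert e B) = rk B"
proof (cases "e \<in> B")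
  case False
  have "rk (insert e A \<union> B) + rk (insert e A \<inter> B) \<le> rk (insert e A) + rk B"
    by (rule rank_submodular)
  moreover have "insert e A \<union> B = insert e B" "insert e A \<inter> B = A" using assms False by auto
  ultimately have "rk (insert e B) \<le> rk B" using assms by simp
  then show ?thesis using rank_mono[of B "insert e B"] by (simp add: subset_insertI)
qed (simp add: insert_absorb)

section \<open>Flats and closure\<close>

lemma flat_iff: "F \<in> flats E I \<longleftrightarrow> F \<subseteq> E \<and> (\<forall>e\<in>E. rk (insert e F) = rk F \<longrightarrow> e \<in> F)"
proof -
  have "rk F < rk (insert e F) \<longleftrightarrow> rk (insert e F) \<noteq> rk F" for e
    using rank_mono[OF subset_insertI, of F e] by linarith
  then show ?thesis by (auto simp: flats_def)
qed

definition closure :: "'a set \<Rightarrow> 'a set" where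
  "closure A = {e \<in> E. rk (insert e A) = rk A}"

lemma closure_subset_ground: "closure A \<subseteq> E"
  by (auto simp: closure_def)

lemma subset_closure: "A \<subseteq> E \<Longrightarrow> A \<subseteq> closure A"
  by (auto simp: closure_def insert_absorb)

lemma rank_Un_closure:
  assumes "finite B" "B \<subseteq> closure A"
  shows "rk (A \<union> B) = rk A"
  using assms
proof (induction B)
  case (insert b B)
  from insert.prems have "rk (insert b A) = rk A" by (simp add: closure_def)
  then have "rk (insert b (A \<union> B)) = rk (A \<union> B)"
    by (rule rank_insert_mono) simp
  also have "\<dots> = rk A" using insert by simp
  finally show ?case by simp
qed simp

lemma rank_closure: "A \<subseteq> E \<Longrightarrow> rk (closure A) = rk A"
  using rank_Un_closure[of "closure A" A] subset_closure[of A] closure_subset_ground[of A]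
    finite_subset_ground by (simp add: Un_absorb1)

lemma closure_mono: "A \<subseteq> B \<Longrightarrow> closure A \<subseteq> closure B"
  by (auto simp: closure_def intro: rank_insert_mono)

lemma closure_flat: "F \<in> flats E I \<Longrightarrow> closure F = F"
  by (auto simp: flat_iff closure_def insert_absorb)

lemma flat_closure:
  assumes "A \<subseteq> E"
  shows "closure A \<in> flats E I"
  unfolding flat_iff
proof (intro conjI ballI impI closure_subset_ground)
  fix e assume e: "e \<in> E" "rk (insert e (closure A)) = rk (closure A)"
  have "rk (insert e A) \<le> rk (insert e (closure A))"
    using subset_closure[OF assms] by (intro rank_mono) auto
  also have "\<dots> = rk A" using e rank_closure[OF assms] by simp
  finally have "rk (insert e A) = rk A" using rank_mono[of A "insert e A"] by (simp add: subset_insertI)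
  then show "e \<in> closure A" using e by (simp add: closure_def)
qed

lemma flat_Int:
  assumes "F \<in> flats E I" "G \<in> flats E I"
  shows "F \<inter> G \<in> flats E I"
  unfolding flat_iff
proof (intro conjI ballI impI IntI)
  fix e assume e: "e \<in> E" "rk (insert e (F \<inter> G)) = rk (F \<inter> G)"
  then show "e \<in> F" "e \<in> G"
    using assms rank_insert_mono[OF e(2), of F] rank_insert_mono[OF e(2), of G] by (auto simp: flat_iff)
qed (use assms in \<open>auto simp: flat_iff\<close>)

section \<open>Circuits\<close>

lemma obtain_circuit:
  assumes "A \<subseteq> E" "A \<notin> I"
  obtains C where "C \<in> circuits E I" "C \<subseteq> A"
proof -
  have "\<exists>C \<in> circuits E I. C \<subseteq> A"
    using assms
  proof (induction "card A" arbitrary: A rule: less_induct)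
    case less
    show ?case
    proof (cases "A \<in> circuits E I")
      case False
      then obtain X where X: "X \<subset> A" "X \<notin> I" using less.prems by (auto simp: circuits_def)
      then have "card X < card A" using less.prems finite_subset_ground by (intro psubset_card_mono) auto
      with X less.prems have "\<exists>C \<in> circuits E I. C \<subseteq> X" by (intro less.hyps) auto
      then show ?thesis using X by blast
    qed auto
  qed
  then show ?thesis using that by blast
qed

lemma circuit_rank:
  assumes "C \<in> circuits E I" "e \<in> C"
  shows "rk (C - {e}) = rk C" "Suc (rk C) = card C"
proof -
  have C: "C \<subseteq> E" "C \<notin> I" "C - {e} \<in> I" using assms by (auto simp: circuits_def)
  have fin: "finite C" using C finite_subset_ground by blast
  have "rk (C - {e}) = card (C - {e})" using C indep_iff_rank[of "C - {e}"] by blast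
  moreover have "rk C \<noteq> card C" using C indep_iff_rank by blast
  moreover have "rk C \<le> card C" using fin by (rule rank_le_card)
  moreover have "rk (C - {e}) \<le> rk C" by (rule rank_mono) auto
  moreover have "card C = Suc (card (C - {e}))" using fin assms(2) by (rule card.remove)
  ultimately show "rk (C - {e}) = rk C" "Suc (rk C) = card C" by auto
qed

text \<open>If \<open>e\<close> does not raise the rank, adding it to a basis of
  \<open>A - {e}\<close> creates a circuit, which must use \<open>e\<close>. Conversely, the rest of
  a circuit spans \<open>e\<close>, and so does any larger set.\<close>

lemma rank_remove_eq_iff_circuit:
  assumes A: "A \<subseteq> E" and e: "e \<in> A"
  shows "rk (A - {e}) = rk A \<longleftrightarrow> (\<exists>C\<in>circuits E I. e \<in> C \<and> C \<subseteq> A)"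
proof
  assume eq: "rk (A - {e}) = rk A"
  obtain X where X: "X \<in> I" "X \<subseteq> A - {e}" "card X = rk (A - {e})" by (rule obtain_basis)
  have "insert e X \<notin> I"
  proof
    assume "insert e X \<in> I"
    then have "card (insert e X) \<le> rk A" using X e by (intro card_le_rank) auto
    moreover have "card (insert e X) = Suc (card X)" using X finite_indep by (subst card_insert_disjoint) auto
    ultimately show False using X eq by simp
  qed
  moreover have "insert e X \<subseteq> E" using X A e by auto
  ultimately obtain C where C: "C \<in> circuits E I" "C \<subseteq> insert e X" using obtain_circuit by metis
  have "e \<in> C"
  proof (rule ccontr)
    assume "e \<notin> C"
    then have "C \<subseteq> X" using C by auto
    then show False using C(1) X indep_hereditary by (auto simp: circuits_def)
  qed
  then show "\<exists>C\<in>circuits E I. e \<in> C \<and> C \<subseteq> A" using C X e by blast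
next
  assume "\<exists>C\<in>circuits E I. e \<in> C \<and> C \<subseteq> A"
  then obtain C where C: "C \<in> circuits E I" "e \<in> C" "C \<subseteq> A" by blast
  have "rk (insert e (C - {e})) = rk (C - {e})" using circuit_rank[OF C(1,2)] C by (simp add: insert_absorb)
  then have "rk (insert e (A - {e})) = rk (A - {e})"
    by (rule rank_insert_mono) (use C in auto)
  moreover have "insert e (A - {e}) = A" using e by auto
  ultimately show "rk (A - {e}) = rk A" by simp
qed

text \<open>The right-hand side says that the restriction to \<open>A\<close> has no coloop. It
  replaces circuits by ranks in the later arguments.\<close>

lemma union_of_circuits_iff:
  assumes "A \<subseteq> E"
  shows "(\<exists>\<C>\<subseteq>circuits E I. A = \<Union>\<C>) \<longleftrightarrow> (\<forall>e\<in>A. rk (A - {e}) = rk A)"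
proof
  assume "\<exists>\<C>\<subseteq>circuits E I. A = \<Union>\<C>"
  then obtain \<C> where "\<C> \<subseteq> circuits E I" "A = \<Union>\<C>" by blast
  then have "\<exists>C\<in>circuits E I. e \<in> C \<and> C \<subseteq> A" if "e \<in> A" for e using that by blast
  then show "\<forall>e\<in>A. rk (A - {e}) = rk A"
    by (simp add: rank_remove_eq_iff_circuit[OF assms])
next
  assume *: "\<forall>e\<in>A. rk (A - {e}) = rk A"
  show "\<exists>\<C>\<subseteq>circuits E I. A = \<Union>\<C>"
  proof (intro exI conjI)
    have "\<exists>C\<in>circuits E I. e \<in> C \<and> C \<subseteq> A" if "e \<in> A" for e
      using * that by (simp flip: rank_remove_eq_iff_circuit[OF assms])
    then show "A = \<Union> {C \<in> circuits E I. C \<subseteq> A}" by blast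
  qed auto
qed

section \<open>Cyclic flats and their lattice\<close>

lemma cyclic_flat_iff:
  "F \<in> cyclic_flats E I \<longleftrightarrow> F \<in> flats E I \<and> (\<forall>e\<in>F. rk (F - {e}) = rk F)"
proof -
  have "F \<in> flats E I \<Longrightarrow> F \<subseteq> E" by (simp add: flats_def)
  then show ?thesis unfolding cyclic_flats_def mem_Collect_eq
    using union_of_circuits_iff[of F] by blast
qed

lemma cyclic_flat_subset: "F \<in> cyclic_flats E I \<Longrightarrow> F \<subseteq> E"
  by (auto simp: cyclic_flats_def flats_def)

lemma finite_cyclic_flats: "finite (cyclic_flats E I)"
  by (rule finite_subset[of _ "Pow E"]) (auto simp: finite_ground dest: cyclic_flat_subset)

lemma circuit_subset: "C \<in> circuits E I \<Longrightarrow> C \<subseteq> E"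
  by (auto simp: circuits_def)

lemma cyclic_closure:
  assumes A: "A \<subseteq> E" and cyc: "\<forall>e\<in>A. rk (A - {e}) = rk A"
  shows "closure A \<in> cyclic_flats E I"
  unfolding cyclic_flat_iff
proof (intro conjI ballI)
  fix e assume e: "e \<in> closure A"
  have "rk A \<le> rk (closure A - {e})"
  proof (cases "e \<in> A")
    case True
    then have "rk A = rk (A - {e})" using cyc by simp
    also have "\<dots> \<le> rk (closure A - {e})" using subset_closure[OF A] by (intro rank_mono) auto
    finally show ?thesis .
  next
    case False
    then show ?thesis using subset_closure[OF A] by (intro rank_mono) auto
  qed
  moreover have "rk (closure A - {e}) \<le> rk (closure A)" by (rule rank_mono) auto
  ultimately show "rk (closure A - {e}) = rk (closure A)" using rank_closure[OF A] by simp
qed (rule flat_closure[OF A])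

text \<open>Take the closure of the union \<open>K\<close> of all circuits in \<open>A\<close>. The
  elements of \<open>A - K\<close> are coloops of the restriction to \<open>A\<close>, so each of
  them adds one to the rank.\<close>

lemma obtain_cyclic_flat:
  assumes A: "A \<subseteq> E"
  obtains Z where "Z \<in> cyclic_flats E I" "Z \<subseteq> closure A" "rk A = rk Z + card (A - Z)"
    "\<forall>C\<in>circuits E I. C \<subseteq> A \<longrightarrow> C \<subseteq> Z"
proof -
  define K where "K = \<Union> {C \<in> circuits E I. C \<subseteq> A}"
  have KA: "K \<subseteq> A" and KE: "K \<subseteq> E" using A by (auto simp: K_def)
  have "\<exists>\<C>\<subseteq>circuits E I. K = \<Union>\<C>"
    by (intro exI[of _ "{C \<in> circuits E I. C \<subseteq> A}"]) (auto simp: K_def)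
  then have cyc: "\<forall>e\<in>K. rk (K - {e}) = rk K" by (simp only: union_of_circuits_iff[OF KE])
  \<comment> \<open>The elements of \<open>B\<close> are added one at a time; none of them lies on a
    circuit inside \<open>A\<close>, so every step raises the rank.\<close>
  have *: "rk (K \<union> B) = rk K + card B" if "B \<subseteq> A - K" for B
  proof -
    have "finite B" using that A by (intro finite_subset_ground) auto
    then show ?thesis using that
    proof (induction B)
      case (insert b B)
      let ?S = "insert b (K \<union> B)"
      have S: "?S \<subseteq> A" using insert KA by auto
      have "\<not> (\<exists>C\<in>circuits E I. b \<in> C \<and> C \<subseteq> ?S)"
      proof
        assume "\<exists>C\<in>circuits E I. b \<in> C \<and> C \<subseteq> ?S"
        then have "b \<in> K" using S unfolding K_def by blast
        then show False using insert.prems by auto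
      qed
      moreover have "rk (?S - {b}) = rk ?S \<longleftrightarrow> (\<exists>C\<in>circuits E I. b \<in> C \<and> C \<subseteq> ?S)"
        by (rule rank_remove_eq_iff_circuit) (use S A in auto)
      moreover have "?S - {b} = K \<union> B" using insert by auto
      moreover have "rk ?S \<le> Suc (rk (K \<union> B))" using insert A by (intro rank_insert_le) auto
      moreover have "rk (K \<union> B) \<le> rk ?S" by (rule rank_mono) auto
      ultimately show ?case using insert by auto
    qed simp
  qed
  have rA: "rk A = rk K + card (A - K)" using *[of "A - K"] KA by (simp add: Un_absorb1)
  let ?Z = "closure K"
  \<comment> \<open>The closure keeps the rank of \<open>K\<close> and can only absorb elements of
    \<open>A - K\<close>; the general bound \<open>rank_le_add_card_Diff\<close> then forces
    equality.\<close>
  have "card (A - ?Z) \<le> card (A - K)"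
    using subset_closure[OF KE] finite_subset_ground[OF A] by (intro card_mono) auto
  then have "rk A = rk ?Z + card (A - ?Z)"
    using rA rank_closure[OF KE] rank_le_add_card_Diff[OF A, of ?Z] by simp
  moreover have "\<forall>C\<in>circuits E I. C \<subseteq> A \<longrightarrow> C \<subseteq> ?Z"
    using subset_closure[OF KE] by (auto simp: K_def)
  ultimately show ?thesis
    using that cyclic_closure[OF KE cyc] closure_mono[OF KA] by blast
qed

text \<open>A cyclic flat attaining the rank bound for \<open>X\<close> gives
  \<open>card X \<le> rk X\<close>. Thus cyclic flats and their ranks determine a matroid.\<close>

lemma indep_iff_cyclic_flats:
  "X \<in> I \<longleftrightarrow> X \<subseteq> E \<and> (\<forall>Z\<in>cyclic_flats E I. card (X \<inter> Z) \<le> rk Z)"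
proof (intro iffI conjI ballI)
  fix Z assume "X \<in> I"
  then show "card (X \<inter> Z) \<le> rk Z" by (intro card_le_rank) (auto intro: indep_hereditary)
next
  assume X: "X \<subseteq> E \<and> (\<forall>Z\<in>cyclic_flats E I. card (X \<inter> Z) \<le> rk Z)"
  then obtain Z where Z: "Z \<in> cyclic_flats E I" "rk X = rk Z + card (X - Z)"
    by (meson obtain_cyclic_flat)
  have "card X = card (X \<inter> Z) + card (X - Z)"
    using X finite_subset_ground by (metis card_Int_Diff)
  then have "card X \<le> rk X" using X Z by fastforce
  then show "X \<in> I" using X indep_iff_rank rank_le_card finite_subset_ground by (metis order_antisym)
qed (rule indep_subset)

lemma cyclic_flat_join:
  assumes "Z \<in> cyclic_flats E I" "W \<in> cyclic_flats E I"
  obtains J where "J \<in> cyclic_flats E I" "Z \<union> W \<subseteq> J" "rk J = rk (Z \<union> W)"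
proof -
  have sub: "Z \<union> W \<subseteq> E" using assms cyclic_flat_subset by blast
  obtain C D where "C \<subseteq> circuits E I" "Z = \<Union>C" "D \<subseteq> circuits E I" "W = \<Union>D"
    using assms by (auto simp: cyclic_flats_def)
  then have "\<exists>\<C>\<subseteq>circuits E I. Z \<union> W = \<Union>\<C>" by (intro exI[of _ "C \<union> D"]) auto
  then have "\<forall>e\<in>Z \<union> W. rk (Z \<union> W - {e}) = rk (Z \<union> W)" by (simp only: union_of_circuits_iff[OF sub])
  then have "closure (Z \<union> W) \<in> cyclic_flats E I" by (rule cyclic_closure[OF sub])
  then show ?thesis using that subset_closure[OF sub] rank_closure[OF sub] by blast
qed

text \<open>The intersection is a flat but may have coloops. \<open>K\<close> is what its circuits
  generate, and the elements of \<open>Z \<inter> W - K\<close> are those coloops, whence the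
  correction term in the rank.\<close>

lemma cyclic_flat_meet:
  assumes Z: "Z \<in> cyclic_flats E I" and W: "W \<in> cyclic_flats E I"
  obtains K where "K \<in> cyclic_flats E I" "K \<subseteq> Z" "K \<subseteq> W" "rk (Z \<inter> W) = rk K + card (Z \<inter> W - K)"
    "\<forall>Y\<in>cyclic_flats E I. Y \<subseteq> Z \<longrightarrow> Y \<subseteq> W \<longrightarrow> Y \<subseteq> K"
proof -
  have fl: "Z \<inter> W \<in> flats E I" using Z W by (intro flat_Int) (auto simp: cyclic_flats_def)
  then have "Z \<inter> W \<subseteq> E" by (auto simp: flats_def)
  then obtain K where K: "K \<in> cyclic_flats E I" "K \<subseteq> closure (Z \<inter> W)" "rk (Z \<inter> W) = rk K + card (Z \<inter> W - K)"
    "\<forall>C\<in>circuits E I. C \<subseteq> Z \<inter> W \<longrightarrow> C \<subseteq> K" by (rule obtain_cyclic_flat)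
  have "\<forall>Y\<in>cyclic_flats E I. Y \<subseteq> Z \<longrightarrow> Y \<subseteq> W \<longrightarrow> Y \<subseteq> K"
    using K(4) unfolding cyclic_flats_def by blast
  then show ?thesis using that K closure_flat[OF fl] by auto
qed

text \<open>This is \<open>obtain_cyclic_flat\<close> for the whole ground set: the elements outside
  all circuits are the coloops of the matroid.\<close>

lemma top_cyclic_flat:
  "top_cyclic_flat E I \<in> cyclic_flats E I"
  "rk E = rk (top_cyclic_flat E I) + card (E - top_cyclic_flat E I)"
proof -
  obtain Z where Z: "Z \<in> cyclic_flats E I" "Z \<subseteq> closure E" "rk E = rk Z + card (E - Z)"
    "\<forall>C\<in>circuits E I. C \<subseteq> E \<longrightarrow> C \<subseteq> Z"
    by (rule obtain_cyclic_flat[OF order_refl])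
  have "Z = top_cyclic_flat E I"
  proof
    show "Z \<subseteq> top_cyclic_flat E I" using Z(1) by (auto simp: cyclic_flats_def top_cyclic_flat_def)
    show "top_cyclic_flat E I \<subseteq> Z"
      unfolding top_cyclic_flat_def using Z(4) circuit_subset by (intro Union_least) blast
  qed
  then show "top_cyclic_flat E I \<in> cyclic_flats E I"
    "rk E = rk (top_cyclic_flat E I) + card (E - top_cyclic_flat E I)" using Z by auto
qed

lemma cyclic_flat_subset_top: "Z \<in> cyclic_flats E I \<Longrightarrow> Z \<subseteq> top_cyclic_flat E I"
  by (auto simp: cyclic_flats_def top_cyclic_flat_def)

lemma empty_flat_iff: "{} \<in> flats E I \<longleftrightarrow> loopfree E I"
proof -
  have "{e} \<in> I \<longleftrightarrow> 0 < rk {e}" if "e \<in> E" for e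
    using that indep_iff_rank[of "{e}"] rank_le_card[of "{e}"] by auto
  then show ?thesis by (simp add: flats_def loopfree_def)
qed

lemma empty_cyclic_flat_iff: "{} \<in> cyclic_flats E I \<longleftrightarrow> loopfree E I"
  by (simp add: cyclic_flat_iff empty_flat_iff)

lemma flat_rank_less:
  assumes "F \<in> flats E I" "F \<subset> G" "G \<subseteq> E"
  shows "rk F < rk G"
proof -
  obtain e where e: "e \<in> G" "e \<notin> F" using assms by auto
  then have "rk F < rk (insert e F)" using assms by (auto simp: flats_def)
  also have "\<dots> \<le> rk G" using e assms by (intro rank_mono) auto
  finally show ?thesis .
qed

end

section \<open>Nested matroids\<close>

text \<open>Supplies the uniqueness for the description in \<open>nested_matroid\<close>.\<close>

lemma indep_eq_of_cyclic_flats: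
  assumes "matroid E I" "matroid E J" "cyclic_flats E I = cyclic_flats E J"
    and "\<forall>Z\<in>cyclic_flats E J. mat_rank I Z = mat_rank J Z"
  shows "I = J"
  using matroid.indep_iff_cyclic_flats[OF assms(1)] matroid.indep_iff_cyclic_flats[OF assms(2)] assms(3,4)
  by auto

text \<open>For a chain \<open>T\<close> of cyclic flats with their ranks \<open>\<rho>\<close>, these are the independent sets of the
  nested matroid \<open>M\<langle>T\<rangle>\<close>.\<close>

definition chain_indep :: "'a set \<Rightarrow> ('a set \<Rightarrow> nat) \<Rightarrow> 'a set set \<Rightarrow> 'a set set" where
  "chain_indep E \<rho> T = {X. X \<subseteq> E \<and> (\<forall>Z\<in>T. card (X \<inter> Z) \<le> \<rho> Z)}"

text \<open>The tight members of the chain include \<open>{}\<close>, so their union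
  \<open>Z\<close> is the largest of them. A member containing some \<open>y\<close> outside
  \<open>Z\<close> is not tight and has room for \<open>y\<close>. So one set accounts for all
  obstructions to extending \<open>X\<close>.\<close>

lemma obtain_largest_tight:
  assumes E: "finite E" and T: "T \<subseteq> Pow E" "chain_subset T" "{} \<in> T" and \<rho>: "\<rho> {} = 0"
    and X: "X \<in> chain_indep E \<rho> T"
  obtains Z where "Z \<in> T" "card (X \<inter> Z) = \<rho> Z" "\<forall>y\<in>E - X - Z. insert y X \<in> chain_indep E \<rho> T"
proof -
  let ?S = "{Z \<in> T. card (X \<inter> Z) = \<rho> Z}"
  have finT: "finite T" using T(1) E by (meson finite_Pow_iff finite_subset)
  have XE: "X \<subseteq> E" using X by (simp add: chain_indep_def)
  have finX: "finite X" using XE E finite_subset by blast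
  have "\<Union> ?S \<in> ?S"
  proof (rule Union_in_chain)
    show "?S \<noteq> {}" using T(3) \<rho> by auto
    show "subset.chain UNIV ?S" using T(2) by (auto simp: subset.chain_def chain_subset_def)
  qed (use finT in auto)
  moreover have "insert y X \<in> chain_indep E \<rho> T" if y: "y \<in> E - X - \<Union> ?S" for y
    unfolding chain_indep_def
  proof (intro CollectI conjI ballI)
    fix W assume W: "W \<in> T"
    have le: "card (X \<inter> W) \<le> \<rho> W" using X W by (simp add: chain_indep_def)
    show "card (insert y X \<inter> W) \<le> \<rho> W"
    proof (cases "y \<in> W")
      case True
      then have "card (X \<inter> W) \<noteq> \<rho> W" using y W by auto
      then show ?thesis using True le finX y by simp
    qed (use le in simp)
  qed (use XE y in auto)
  ultimately show ?thesis using that by blast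
qed

text \<open>For the exchange axiom, take the largest tight set \<open>Z\<close> of \<open>X\<close>.
  Since \<open>Y\<close> has at most as many elements in \<open>Z\<close> as \<open>X\<close>, it
  has more outside, and any new one among these can be added.\<close>

lemma matroid_chain_indep:
  assumes E: "finite E" and T: "T \<subseteq> Pow E" "chain_subset T" "{} \<in> T" and \<rho>: "\<rho> {} = 0"
  shows "matroid E (chain_indep E \<rho> T)"
proof
  show "finite E" by fact
  show "{} \<in> chain_indep E \<rho> T" by (simp add: chain_indep_def)
  fix X assume X: "X \<in> chain_indep E \<rho> T"
  then show XE: "X \<subseteq> E" by (simp add: chain_indep_def)
  have finX: "finite X" using XE E finite_subset by blast
  show "Y \<in> chain_indep E \<rho> T" if "Y \<subseteq> X" for Y
    unfolding chain_indep_def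
  proof (intro CollectI conjI ballI)
    fix Z assume "Z \<in> T"
    have "card (Y \<inter> Z) \<le> card (X \<inter> Z)" using finX that by (intro card_mono) auto
    also have "\<dots> \<le> \<rho> Z" using X \<open>Z \<in> T\<close> by (simp add: chain_indep_def)
    finally show "card (Y \<inter> Z) \<le> \<rho> Z" .
  qed (use XE that in auto)
  fix Y assume Y: "Y \<in> chain_indep E \<rho> T" and lt: "card X < card Y"
  obtain Z where Z: "Z \<in> T" "card (X \<inter> Z) = \<rho> Z" "\<forall>y\<in>E - X - Z. insert y X \<in> chain_indep E \<rho> T"
    by (rule obtain_largest_tight[OF E T \<rho> X])
  have YE: "Y \<subseteq> E" using Y by (simp add: chain_indep_def)
  have finY: "finite Y" using YE E finite_subset by blast
  have "card (Y \<inter> Z) \<le> card (X \<inter> Z)" using Y Z by (simp add: chain_indep_def)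
  moreover have "card Y = card (Y \<inter> Z) + card (Y - Z)" "card X = card (X \<inter> Z) + card (X - Z)"
    using finX finY by (simp_all add: card_Int_Diff)
  ultimately have "card (X - Z) < card (Y - Z)" using lt by linarith
  then have "\<not> Y - Z \<subseteq> X - Z" using finX card_mono[of "X - Z" "Y - Z"] by auto
  then obtain y where "y \<in> Y" "y \<notin> Z" "y \<notin> X" by auto
  then show "\<exists>y\<in>Y - X. insert y X \<in> chain_indep E \<rho> T" using Z(3) YE by blast
qed

lemma (in matroid) nested_matroid:
  assumes T: "T \<in> cyclic_chains E I"
  defines "J \<equiv> nested_matroid E I T"
  shows "matroid E J" "cyclic_flats E J = T" "\<And>Z. Z \<in> T \<Longrightarrow> mat_rank J Z = rk Z"
    "I \<subseteq> J" "mat_rank J E = rk E"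
proof -
  have TZ: "T \<subseteq> cyclic_flats E I" and chain: "chain_subset T" and emp: "{} \<in> T" and top: "top_cyclic_flat E I \<in> T"
    using T by (auto simp: cyclic_chains_def)
  have TE: "T \<subseteq> Pow E" using TZ cyclic_flat_subset by blast
  let ?J = "chain_indep E rk T"
  interpret J: matroid E ?J
    by (rule matroid_chain_indep) (use finite_ground TE chain emp in auto)
  \<comment> \<open>By \<open>indep_iff_cyclic_flats\<close>, \<open>?J\<close> keeps only the
    constraints of \<open>I\<close> that come from \<open>T\<close>.\<close>
  have IJ: "I \<subseteq> ?J"
  proof
    fix X assume "X \<in> I"
    then show "X \<in> ?J" using indep_iff_cyclic_flats[of X] TZ by (auto simp: chain_indep_def)
  qed
  have rk_le: "rk A \<le> J.rk A" for A
    using rank_le[of A "J.rk A"] J.card_le_rank IJ by blast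
  have rk_eq: "J.rk Z = rk Z" if "Z \<in> T" for Z
  proof (rule order_antisym)
    show "J.rk Z \<le> rk Z"
    proof (rule J.rank_le)
      fix X assume "X \<in> ?J" "X \<subseteq> Z"
      then show "card X \<le> rk Z" using that by (auto simp: chain_indep_def Int_absorb2)
    qed
  qed (rule rk_le)
  \<comment> \<open>For a basis \<open>X\<close> of \<open>A\<close> with largest tight set
    \<open>Z\<close>, an element of \<open>A - Z\<close> missing from \<open>X\<close> could be
    added, contradicting maximality.\<close>
  have formula: "\<exists>Z\<in>T. J.rk A = rk Z + card (A - Z)" if A: "A \<subseteq> E" for A
  proof -
    obtain X where X: "X \<in> ?J" "X \<subseteq> A" "card X = J.rk A" by (rule J.obtain_basis)
    obtain Z where Z: "Z \<in> T" "card (X \<inter> Z) = rk Z" "\<forall>y\<in>E - X - Z. insert y X \<in> ?J"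
      by (rule obtain_largest_tight[OF finite_ground TE chain emp rank_empty X(1)])
    have "A - Z \<subseteq> X"
    proof
      fix y assume y: "y \<in> A - Z"
      show "y \<in> X"
      proof (rule ccontr)
        assume "y \<notin> X"
        then have "insert y X \<in> ?J" using y A Z(3) by auto
        then have "card (insert y X) \<le> J.rk A" using y X(2) by (intro J.card_le_rank) auto
        then show False using X(3) \<open>y \<notin> X\<close> J.finite_indep[OF X(1)] by simp
      qed
    qed
    then have "X - Z = A - Z" using X(2) by auto
    moreover have "card X = card (X \<inter> Z) + card (X - Z)" using J.finite_indep[OF X(1)] by (simp add: card_Int_Diff)
    ultimately show ?thesis using Z X(3) by auto
  qed
  have J_cyc: "cyclic_flats E ?J = T"
  proof (intro equalityI subsetI)
    \<comment> \<open>The new rank agrees with the old one on \<open>Z\<close> and is nowhere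
      smaller, so \<open>Z\<close> remains closed and without coloops.\<close>
    fix Z assume Z: "Z \<in> T"
    then have ZI: "Z \<in> flats E I" "\<forall>e\<in>Z. rk (Z - {e}) = rk Z" using TZ by (auto simp: cyclic_flat_iff)
    show "Z \<in> cyclic_flats E ?J"
      unfolding J.cyclic_flat_iff
    proof (intro conjI ballI)
      have "J.rk Z < J.rk (insert e Z)" if "e \<in> E - Z" for e
      proof -
        have "rk Z < rk (insert e Z)" using that ZI(1) by (simp add: flats_def)
        then show ?thesis using rk_eq[OF Z] rk_le[of "insert e Z"] by simp
      qed
      then show "Z \<in> flats E ?J" using TE Z by (auto simp: flats_def)
      fix e assume "e \<in> Z"
      then show "J.rk (Z - {e}) = J.rk Z"
        using ZI(2) rk_le[of "Z - {e}"] rk_eq[OF Z] J.rank_mono[OF Diff_subset, of Z "{e}"] by fastforce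
    qed
  next
    fix F assume "F \<in> cyclic_flats E ?J"
    then have F: "F \<in> flats E ?J" "\<And>e. e \<in> F \<Longrightarrow> J.rk (F - {e}) = J.rk F" "F \<subseteq> E"
      by (auto simp: J.cyclic_flat_iff flats_def)
    obtain Z where Z: "Z \<in> T" "J.rk F = rk Z + card (F - Z)" using formula[OF F(3)] by blast
    have ZE: "Z \<subseteq> E" using Z TE by blast
    \<comment> \<open>An element of \<open>F\<close> outside \<open>Z\<close> would be a coloop of
      the restriction to \<open>F\<close>. So \<open>F\<close> lies in \<open>Z\<close> and has the
      same rank; being a flat, it equals \<open>Z\<close>.\<close>
    have "F \<subseteq> Z"
    proof (rule ccontr)
      assume "\<not> F \<subseteq> Z"
      then obtain e where e: "e \<in> F" "e \<notin> Z" by auto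
      have "J.rk (F - {e}) \<le> J.rk Z + card (F - {e} - Z)" by (rule J.rank_le_add_card_Diff) (use F in auto)
      moreover have "card (F - Z) = Suc (card (F - Z - {e}))"
        using e F(3) J.finite_subset_ground by (intro card.remove) auto
      moreover have "F - {e} - Z = F - Z - {e}" by auto
      ultimately show False using F(2)[OF e(1)] Z rk_eq[OF Z(1)] by simp
    qed
    then have "F - Z = {}" by auto
    then have "\<not> F \<subset> Z" using J.flat_rank_less[OF F(1) _ ZE] Z rk_eq[OF Z(1)] by auto
    with \<open>F \<subseteq> Z\<close> show "F \<in> T" using Z(1) by auto
  qed
  have "J = ?J"
    unfolding J_def nested_matroid_def
  proof (rule the_equality)
    show "matroid E ?J \<and> cyclic_flats E ?J = T \<and> (\<forall>Z\<in>T. J.rk Z = rk Z)"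
      using J_cyc rk_eq J.matroid_axioms by auto
    show "K = ?J" if "matroid E K \<and> cyclic_flats E K = T \<and> (\<forall>Z\<in>T. mat_rank K Z = rk Z)" for K
      by (rule indep_eq_of_cyclic_flats[OF _ J.matroid_axioms]) (use that J_cyc rk_eq in simp_all)
  qed
  \<comment> \<open>The top cyclic flat belongs to \<open>T\<close>, and the coloops outside it add
    at most their number.\<close>
  moreover have "J.rk E \<le> rk E"
    using J.rank_le_add_card_Diff[OF order_refl, of "top_cyclic_flat E I"] rk_eq[OF top] top_cyclic_flat(2) by simp
  ultimately show "matroid E J" "cyclic_flats E J = T" "\<And>Z. Z \<in> T \<Longrightarrow> mat_rank J Z = rk Z"
    "I \<subseteq> J" "mat_rank J E = rk E"
    using J.matroid_axioms J_cyc rk_eq IJ rk_le[of E] by auto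
qed

section \<open>Chains of flats\<close>

text \<open>The weight \<open>x\<close> is the barycentre of the polytope of the direct sum of the rank-one uniform
  matroids on the blocks \<open>F (i + 1) - F i\<close>; only the listed properties matter.\<close>

locale weighted_chain =
  fixes E :: "'a set" and r :: nat and F :: "nat \<Rightarrow> 'a set" and x :: "'a \<Rightarrow> real"
  assumes finite_E: "finite E"
    and F_0: "F 0 = {}" and F_r: "F r = E"
    and F_Suc: "i < r \<Longrightarrow> F i \<subset> F (Suc i)"
    and x_pos: "e \<in> E \<Longrightarrow> 0 < x e" and x_le_1: "e \<in> E \<Longrightarrow> x e \<le> 1"
    and sum_F: "i \<le> r \<Longrightarrow> sum x (F i) = real i"
begin

lemma F_mono: "i \<le> j \<Longrightarrow> j \<le> r \<Longrightarrow> F i \<subseteq> F j"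
proof (induction j rule: dec_induct)
  case (step n)
  then show ?case using F_Suc[of n] by auto
qed simp

lemma F_subset: "i \<le> r \<Longrightarrow> F i \<subseteq> E"
  using F_mono[of i r] F_r by simp

lemma finite_sub: "A \<subseteq> E \<Longrightarrow> finite A"
  using finite_E finite_subset by blast

lemma sum_x_mono: "A \<subseteq> B \<Longrightarrow> B \<subseteq> E \<Longrightarrow> sum x A \<le> sum x B"
  using finite_sub by (intro sum_mono2) (auto intro!: less_imp_le[OF x_pos])

lemma sum_x_le_card: "A \<subseteq> E \<Longrightarrow> sum x A \<le> card A"
  using sum_bounded_above[of A x 1] x_le_1 by auto

lemma sum_x_split: "A \<subseteq> E \<Longrightarrow> sum x A = sum x (A \<inter> Z) + sum x (A - Z)"
  using finite_sub sum.Int_Diff by blast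

end

lemma exists_weighted_chain:
  assumes fin: "finite E" and F0: "F 0 = {}" and Fr: "F r = E"
    and F_Suc: "\<And>i. i < r \<Longrightarrow> F i \<subset> F (Suc i)"
  shows "\<exists>x. weighted_chain E r F x"
proof -
  have mono: "F i \<subseteq> F j" if "i \<le> j" "j \<le> r" for i j
    using that
  proof (induction j rule: dec_induct)
    case (step n)
    then show ?case using F_Suc[of n] by auto
  qed simp
  have sub: "F i \<subseteq> E" if "i \<le> r" for i using mono[of i r] that Fr by simp
  \<comment> \<open>The least \<open>i\<close> with \<open>e \<in> F (Suc i)\<close> indexes the
    block containing \<open>e\<close>.\<close>
  define x where "x e = 1 / real (card (F (Suc (LEAST i. e \<in> F (Suc i))) - F (LEAST i. e \<in> F (Suc i))))" for e
  have xeq: "x e = 1 / real (card (F (Suc i) - F i))" if "i < r" "e \<in> F (Suc i) - F i" for i e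
  proof -
    have "(LEAST i. e \<in> F (Suc i)) = i"
    proof (rule Least_equality)
      show "e \<in> F (Suc i)" using that by simp
      fix j assume "e \<in> F (Suc j)"
      then have "\<not> Suc j \<le> i" using that mono[of "Suc j" i] by auto
      then show "i \<le> j" by simp
    qed
    then show ?thesis by (simp add: x_def)
  qed
  have pos: "0 < card (F (Suc i) - F i)" if "i < r" for i
    using F_Suc[OF that] sub[of "Suc i"] that fin finite_subset[of "F (Suc i)" E] by (auto simp: card_gt_0_iff)
  have block: "\<exists>i<r. e \<in> F (Suc i) - F i" if "e \<in> E" for e
  proof -
    have e: "e \<in> F r" using that Fr by simp
    have "e \<in> F j \<Longrightarrow> \<exists>i<j. e \<in> F (Suc i) - F i" for j
      by (induction j) (auto simp: F0 less_Suc_eq)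
    from this[OF e] show ?thesis .
  qed
  have "sum x (F i) = real i" if "i \<le> r" for i
    using that
  proof (induction i)
    case (Suc i)
    have fin': "finite (F (Suc i))" using sub[of "Suc i"] Suc fin finite_subset by blast
    have "sum x (F (Suc i)) = sum x (F (Suc i) - F i) + sum x (F i)"
      using F_Suc[of i] Suc fin' by (intro sum.subset_diff) auto
    also have "sum x (F (Suc i) - F i) = (\<Sum>e\<in>F (Suc i) - F i. 1 / real (card (F (Suc i) - F i)))"
      using Suc by (intro sum.cong refl xeq) auto
    also have "\<dots> = 1" using pos[of i] Suc by simp
    finally show ?case using Suc by simp
  qed (simp add: F0)
  moreover have "0 < x e \<and> x e \<le> 1" if e: "e \<in> E" for e
  proof -
    obtain i where i: "i < r" "e \<in> F (Suc i) - F i" using block[OF e] by blast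
    then show ?thesis using xeq[OF i] pos[OF i(1)] by (simp add: Suc_le_eq)
  qed
  ultimately have "weighted_chain E r F x"
    using assms by unfold_locales auto
  then show ?thesis by blast
qed

section \<open>Recognising chains of flats by cyclic flats\<close>

context matroid
begin

lemma chain_of_flats_iff:
  assumes "weighted_chain E r F x" and lf: "loopfree E I" and rkE: "rk E = r"
  shows "(\<forall>i\<le>r. F i \<in> flats E I) \<longleftrightarrow>
    (\<forall>Z\<in>cyclic_flats E I. sum x Z \<le> rk Z) \<and> (\<forall>i\<le>r. \<exists>Z\<in>cyclic_flats E I. rk Z + card (F i - Z) \<le> i)"
proof -
  interpret weighted_chain E r F x by fact
  show ?thesis
  proof (intro iffI conjI ballI allI impI)
    assume fl: "\<forall>i\<le>r. F i \<in> flats E I"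
    fix Z assume "Z \<in> cyclic_flats E I"
    then have ZE: "Z \<subseteq> E" by (rule cyclic_flat_subset)
    \<comment> \<open>A block that meets \<open>Z\<close> adds at most its total mass one to the
      left side. It adds at least one to the rank, because \<open>F i\<close> is a flat and does not
      span the new element.\<close>
    have "sum x (Z \<inter> F i) \<le> rk (Z \<inter> F i)" if "i \<le> r" for i
      using that
    proof (induction i)
      case (Suc i)
      have sub: "F i \<subseteq> F (Suc i)" "F (Suc i) \<subseteq> E" using F_Suc[of i] F_subset[of "Suc i"] Suc by auto
      show ?case
      proof (cases "Z \<inter> F (Suc i) \<subseteq> F i")
        case True
        then have "Z \<inter> F (Suc i) = Z \<inter> F i" using sub by auto
        then show ?thesis using Suc by simp
      next
        case False
        then obtain e where e: "e \<in> Z" "e \<in> F (Suc i)" "e \<notin> F i" by auto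
        have "F i \<in> flats E I" using fl Suc by simp
        then have "rk (insert e (F i)) \<noteq> rk (F i)" using e sub by (auto simp: flat_iff)
        then have "rk (insert e (Z \<inter> F i)) \<noteq> rk (Z \<inter> F i)" using rank_insert_mono[of e "Z \<inter> F i" "F i"] by auto
        then have "rk (Z \<inter> F i) < rk (insert e (Z \<inter> F i))"
          using rank_mono[OF subset_insertI, of "Z \<inter> F i" e] by linarith
        also have "\<dots> \<le> rk (Z \<inter> F (Suc i))" using e sub by (intro rank_mono) auto
        finally have less: "rk (Z \<inter> F i) + 1 \<le> rk (Z \<inter> F (Suc i))" by simp
        have "sum x (Z \<inter> F (Suc i)) = sum x (Z \<inter> F (Suc i) \<inter> F i) + sum x (Z \<inter> F (Suc i) - F i)"
          using sub by (intro sum_x_split) auto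
        also have "Z \<inter> F (Suc i) \<inter> F i = Z \<inter> F i" using sub by auto
        also have "sum x (Z \<inter> F (Suc i) - F i) \<le> sum x (F (Suc i) - F i)"
          using sub by (intro sum_x_mono) auto
        also have "sum x (F (Suc i) - F i) = 1"
        proof -
          have "F (Suc i) \<inter> F i = F i" using sub by auto
          then show ?thesis using sum_x_split[OF sub(2), of "F i"] sum_F[of i] sum_F[of "Suc i"] Suc by simp
        qed
        finally show ?thesis using Suc less by simp
      qed
    qed (simp add: F_0)
    from this[of r] show "sum x Z \<le> rk Z" using ZE by (simp add: F_r Int_absorb2)
  next
    assume fl: "\<forall>i\<le>r. F i \<in> flats E I"
    fix i assume i: "i \<le> r"
    \<comment> \<open>Downward induction from \<open>rk E = r\<close>: the rank strictly increases
      along the flats.\<close>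
    have "rk (F i) + (r - i) \<le> r"
      using i
    proof (induction rule: inc_induct)
      case (step n)
      have "rk (F n) < rk (F (Suc n))"
        using fl F_Suc[of n] F_subset[of "Suc n"] step by (intro flat_rank_less) auto
      then show ?case using step by linarith
    qed (simp add: F_r rkE)
    then have "rk (F i) \<le> i" using i by linarith
    then show "\<exists>Z\<in>cyclic_flats E I. rk Z + card (F i - Z) \<le> i"
      using obtain_cyclic_flat[OF F_subset[OF i]] by metis
  next
    assume *: "(\<forall>Z\<in>cyclic_flats E I. sum x Z \<le> rk Z) \<and> (\<forall>i\<le>r. \<exists>Z\<in>cyclic_flats E I. rk Z + card (F i - Z) \<le> i)"
    \<comment> \<open>The bound passes from cyclic flats to all sets through a cyclic flat attaining
      the rank of \<open>A\<close>; outside it each element has weight at most one.\<close>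
    have x_le: "sum x A \<le> rk A" if A: "A \<subseteq> E" for A
    proof -
      obtain Z where Z: "Z \<in> cyclic_flats E I" "rk A = rk Z + card (A - Z)"
        using obtain_cyclic_flat[OF A] by metis
      have "sum x (A \<inter> Z) \<le> sum x Z" using cyclic_flat_subset[OF Z(1)] by (intro sum_x_mono) auto
      moreover have "sum x (A - Z) \<le> card (A - Z)" using A by (intro sum_x_le_card) auto
      moreover have "sum x Z \<le> rk Z" using * Z by blast
      ultimately show ?thesis using sum_x_split[OF A, of Z] Z(2) by simp
    qed
    fix i assume i: "i \<le> r"
    note Fi = F_subset[OF i]
    obtain Z where Z: "Z \<in> cyclic_flats E I" "rk Z + card (F i - Z) \<le> i" using * i by blast
    have le: "rk (F i) \<le> i" using Z(2) rank_le_add_card_Diff[OF Fi, of Z] by simp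
    show "F i \<in> flats E I"
      unfolding flat_iff
    proof (intro conjI ballI impI Fi)
      fix e assume e: "e \<in> E" "rk (insert e (F i)) = rk (F i)"
      \<comment> \<open>Otherwise the mass of \<open>insert e (F i)\<close> exceeds
        \<open>i\<close>, although its rank is at most \<open>i\<close>.\<close>
      show "e \<in> F i"
      proof (rule ccontr)
        assume "e \<notin> F i"
        then have "sum x (insert e (F i)) = x e + i" using sum_F[OF i] finite_sub[OF Fi] by simp
        moreover have "sum x (insert e (F i)) \<le> rk (insert e (F i))" using e Fi by (intro x_le) auto
        ultimately show False using e le x_pos[of e] by simp
      qed
    qed
  qed
qed

section \<open>Conical contractibility of the violated and spanning flats\<close>

text \<open>The coloops of \<open>Z \<inter> W\<close> are counted in both inequalities and cancel
  in their difference, which makes \<open>sum x Z - rk Z\<close> supermodular. The rank inequality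
  is also used by itself.\<close>

lemma supermodular_meet_join:
  assumes "weighted_chain E r F x"
    and Z: "Z \<in> cyclic_flats E I" and W: "W \<in> cyclic_flats E I"
  obtains K J where "K \<in> cyclic_flats E I" "K \<subseteq> Z" "K \<subseteq> W"
    "\<forall>Y\<in>cyclic_flats E I. Y \<subseteq> Z \<longrightarrow> Y \<subseteq> W \<longrightarrow> Y \<subseteq> K"
    "J \<in> cyclic_flats E I" "Z \<union> W \<subseteq> J"
    "rk J + rk K + card (Z \<inter> W - K) \<le> rk Z + rk W"
    "sum x Z + sum x W \<le> sum x J + sum x K + card (Z \<inter> W - K)"
proof -
  interpret weighted_chain E r F x by fact
  obtain K where K: "K \<in> cyclic_flats E I" "K \<subseteq> Z" "K \<subseteq> W" "rk (Z \<inter> W) = rk K + card (Z \<inter> W - K)"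
    "\<forall>Y\<in>cyclic_flats E I. Y \<subseteq> Z \<longrightarrow> Y \<subseteq> W \<longrightarrow> Y \<subseteq> K"
    by (rule cyclic_flat_meet[OF Z W])
  obtain J where J: "J \<in> cyclic_flats E I" "Z \<union> W \<subseteq> J" "rk J = rk (Z \<union> W)"
    by (rule cyclic_flat_join[OF Z W])
  have sub: "Z \<subseteq> E" "W \<subseteq> E" "J \<subseteq> E" using Z W J cyclic_flat_subset by auto
  have "rk J + rk K + card (Z \<inter> W - K) \<le> rk Z + rk W"
    using rank_submodular[of Z W] K J by simp
  moreover have "sum x Z + sum x W \<le> sum x J + sum x K + card (Z \<inter> W - K)"
  proof -
    have "sum x Z + sum x W = sum x (Z \<union> W) + sum x (Z \<inter> W)"
      using sub finite_sub sum.union_inter[of Z W x] by simp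
    moreover have "sum x (Z \<union> W) \<le> sum x J" using J sub by (intro sum_x_mono)
    moreover have "sum x (Z \<inter> W) = sum x (Z \<inter> W \<inter> K) + sum x (Z \<inter> W - K)"
      using sub by (intro sum_x_split) auto
    moreover have "Z \<inter> W \<inter> K = K" using K by auto
    moreover have "sum x (Z \<inter> W - K) \<le> card (Z \<inter> W - K)" using sub by (intro sum_x_le_card) auto
    ultimately show ?thesis by simp
  qed
  ultimately show ?thesis using that K J by blast
qed

text \<open>In terms of these two families, \<open>F\<close> is a chain of flats iff no cyclic flat is violated and every
  \<open>F i\<close> has a spanning flat (\<open>chain_of_flats_iff\<close>). The value \<open>i\<close> is the smallest possible one of
  \<open>rk Z + card (F i - Z)\<close> unless some flat is violated.\<close>

definition violated :: "('a \<Rightarrow> real) \<Rightarrow> 'a set set" where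
  "violated x = {Z \<in> cyclic_flats E I. real (rk Z) < sum x Z}"

definition spanning_flats :: "(nat \<Rightarrow> 'a set) \<Rightarrow> nat \<Rightarrow> 'a set set" where
  "spanning_flats F i = {Z \<in> cyclic_flats E I. rk Z + card (F i - Z) \<le> i}"

text \<open>Meets are taken among all cyclic flats, so for a suitable apex \<open>m\<close> it
  remains to see that the meet \<open>K\<close> of \<open>m\<close> with a member of
  \<open>W\<close> stays in \<open>W\<close>.\<close>

lemma violated_spanning_conic:
  assumes wc: "weighted_chain E r F x" and J: "J \<subseteq> {..r}"
    and W: "W = violated x \<union> (\<Union>j\<in>J. spanning_flats F j)" "W \<noteq> {}"
  shows "\<exists>m\<in>W. \<forall>Z\<in>W. \<exists>K\<in>W. K \<subseteq> Z \<and> K \<subseteq> m \<and> (\<forall>Y\<in>W. Y \<subseteq> Z \<longrightarrow> Y \<subseteq> m \<longrightarrow> Y \<subseteq> K)"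
proof -
  interpret weighted_chain E r F x by fact
  let ?Z = "cyclic_flats E I"
  define f where "f Z = sum x Z - rk Z" for Z
  have WZ: "W \<subseteq> ?Z" by (auto simp: W(1) violated_def spanning_flats_def)
  \<comment> \<open>For a spanning flat, \<open>j\<close> is the mass of \<open>F j\<close>, which
    is at most \<open>sum x Z + card (F j - Z)\<close>; compare with the defining bound.\<close>
  have f_nonneg: "0 \<le> f Z" if Z: "Z \<in> W" for Z
  proof (cases "Z \<in> violated x")
    case False
    then obtain j where j: "j \<in> J" "rk Z + card (F j - Z) \<le> j" using Z by (auto simp: W(1) spanning_flats_def)
    have jr: "j \<le> r" using j J by auto
    have ZE: "Z \<subseteq> E" using Z WZ cyclic_flat_subset by blast
    have "real j = sum x (F j \<inter> Z) + sum x (F j - Z)"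
      using sum_x_split[OF F_subset[OF jr]] sum_F[OF jr] by simp
    moreover have "sum x (F j \<inter> Z) \<le> sum x Z" using ZE by (intro sum_x_mono) auto
    moreover have "sum x (F j - Z) \<le> card (F j - Z)" using F_subset[OF jr] by (intro sum_x_le_card) auto
    ultimately show ?thesis using j(2) unfolding f_def by linarith
  qed (simp add: violated_def f_def)
  show ?thesis
  proof (cases "violated x = {}")
    case False
    \<comment> \<open>\<open>f\<close> is supermodular on the lattice of cyclic flats, so its inclusion-maximal maximiser is an apex.\<close>
    define A where "A = {Z \<in> ?Z. \<forall>Y\<in>?Z. f Y \<le> f Z}"
    have "Max (f ` ?Z) \<in> f ` ?Z" using False finite_cyclic_flats by (intro Max_in) (auto simp: violated_def)
    then obtain Z0 where "Z0 \<in> ?Z" "f Z0 = Max (f ` ?Z)" by auto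
    then have "Z0 \<in> A" using finite_cyclic_flats by (auto simp: A_def)
    moreover have "finite A" using finite_cyclic_flats by (auto simp: A_def)
    ultimately obtain m where m: "m \<in> A" "\<forall>b\<in>A. m \<subseteq> b \<longrightarrow> m = b"
      using finite_has_maximal[of A] by blast
    have mZ: "m \<in> ?Z" and mmax: "\<And>Y. Y \<in> ?Z \<Longrightarrow> f Y \<le> f m" using m(1) by (auto simp: A_def)
    obtain V where "V \<in> ?Z" "0 < f V" using False by (auto simp: violated_def f_def)
    then have "0 < f m" using mmax[of V] by simp
    then have mW: "m \<in> W" using mZ by (auto simp: W(1) violated_def f_def)
    have conic: "\<exists>K\<in>W. K \<subseteq> Z \<and> K \<subseteq> m \<and> (\<forall>Y\<in>W. Y \<subseteq> Z \<longrightarrow> Y \<subseteq> m \<longrightarrow> Y \<subseteq> K)" if Z: "Z \<in> W" for Z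
    proof -
      have ZZ: "Z \<in> ?Z" using Z WZ by auto
      obtain K L where K: "K \<in> ?Z" "K \<subseteq> Z" "K \<subseteq> m" "\<forall>Y\<in>?Z. Y \<subseteq> Z \<longrightarrow> Y \<subseteq> m \<longrightarrow> Y \<subseteq> K"
        and L: "L \<in> ?Z" "Z \<union> m \<subseteq> L" "rk L + rk K + card (Z \<inter> m - K) \<le> rk Z + rk m"
          "sum x Z + sum x m \<le> sum x L + sum x K + card (Z \<inter> m - K)"
        by (rule supermodular_meet_join[OF wc ZZ mZ])
      have super: "f Z + f m \<le> f L + f K" using L(3,4) unfolding f_def by linarith
      \<comment> \<open>If the join \<open>L\<close> is \<open>m\<close>, then \<open>Z\<close> lies
        below \<open>m\<close> and \<open>K = Z\<close>. Otherwise \<open>L\<close> is not a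
        maximiser, so \<open>f L < f m\<close>, and supermodularity gives
        \<open>f K > f Z \<ge> 0\<close>.\<close>
      have "K \<in> W"
      proof (cases "L = m")
        case True
        then have "K = Z" using L(2) K ZZ by blast
        then show ?thesis using Z by simp
      next
        case False
        then have "L \<notin> A" using m(2) L(2) by blast
        then obtain Y where "Y \<in> ?Z" "f L < f Y" using L(1) by (auto simp: A_def not_le)
        then have "f L < f m" using mmax[of Y] by simp
        then have "0 < f K" using super f_nonneg[OF Z] by simp
        then show ?thesis using K(1) by (simp add: W(1) violated_def f_def)
      qed
      moreover have "\<forall>Y\<in>W. Y \<subseteq> Z \<longrightarrow> Y \<subseteq> m \<longrightarrow> Y \<subseteq> K" using K(4) subsetD[OF WZ] by simp
      ultimately show ?thesis using K(2,3) by (intro bexI[of _ K] conjI)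
    qed
    show ?thesis by (rule bexI[OF _ mW], rule ballI, rule conic)
  next
    case True
    \<comment> \<open>Now any spanning flat for the least possible index is an apex, by submodularity of the rank bound.\<close>
    then have W': "W = (\<Union>j\<in>J. spanning_flats F j)" using W by simp
    define j where "j = (LEAST j. j \<in> J \<and> spanning_flats F j \<noteq> {})"
    have ex: "\<exists>j. j \<in> J \<and> spanning_flats F j \<noteq> {}" using W' W(2) by auto
    have j: "j \<in> J" "spanning_flats F j \<noteq> {}" using LeastI_ex[OF ex] by (simp_all add: j_def)
    have jmin: "j \<le> k" if "k \<in> J" "spanning_flats F k \<noteq> {}" for k
      unfolding j_def using that by (intro Least_le) simp
    obtain m where m: "m \<in> spanning_flats F j" using j by auto
    have mZ: "m \<in> ?Z" and mj: "rk m + card (F j - m) \<le> j" using m by (auto simp: spanning_flats_def)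
    have mW: "m \<in> W" using m j W' by auto
    have conic: "\<exists>K\<in>W. K \<subseteq> Z \<and> K \<subseteq> m \<and> (\<forall>Y\<in>W. Y \<subseteq> Z \<longrightarrow> Y \<subseteq> m \<longrightarrow> Y \<subseteq> K)" if Z: "Z \<in> W" for Z
    proof -
      have ZZ: "Z \<in> ?Z" using Z WZ by auto
      obtain k where k: "k \<in> J" "Z \<in> spanning_flats F k" using Z W' by auto
      have Zk: "rk Z + card (F k - Z) \<le> k" using k by (simp add: spanning_flats_def)
      have jk: "j \<le> k" using jmin k by auto
      have kr: "k \<le> r" using k J by auto
      have Fjk: "F j \<subseteq> F k" using F_mono[OF jk kr] .
      have fin: "finite (F k)" "finite (F j)" using F_subset[of k] F_subset[of j] jk kr finite_sub by auto
      obtain K L where K: "K \<in> ?Z" "K \<subseteq> Z" "K \<subseteq> m" "\<forall>Y\<in>?Z. Y \<subseteq> Z \<longrightarrow> Y \<subseteq> m \<longrightarrow> Y \<subseteq> K"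
        and L: "L \<in> ?Z" "Z \<union> m \<subseteq> L" "rk L + rk K + card (Z \<inter> m - K) \<le> rk Z + rk m"
          "sum x Z + sum x m \<le> sum x L + sum x K + card (Z \<inter> m - K)"
        by (rule supermodular_meet_join[OF wc ZZ mZ])
      have LE: "L \<subseteq> E" using L(1) cyclic_flat_subset by blast
      \<comment> \<open>As \<open>L\<close> is not violated, \<open>k\<close> is a lower bound for
        its spanning value at \<open>F k\<close>.\<close>
      have "sum x L \<le> rk L" using True L(1) by (auto simp: violated_def not_less)
      moreover have "real k = sum x (F k \<inter> L) + sum x (F k - L)"
        using sum_x_split[OF F_subset[OF kr]] sum_F[OF kr] by simp
      moreover have "sum x (F k \<inter> L) \<le> sum x L" using LE by (intro sum_x_mono) auto
      moreover have "sum x (F k - L) \<le> card (F k - L)" using F_subset[OF kr] by (intro sum_x_le_card) auto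
      ultimately have kL: "k \<le> rk L + card (F k - L)" by linarith
      have "card (F j - K) + card (F k - L) \<le> card (F j - m) + card (F k - Z) + card (Z \<inter> m - K)"
      proof -
        have "card (F j - K) \<le> card ((F j - (Z \<inter> m)) \<union> (Z \<inter> m - K))"
          using fin finite_sub[OF cyclic_flat_subset[OF mZ]] by (intro card_mono) auto
        also have "\<dots> \<le> card (F j - (Z \<inter> m)) + card (Z \<inter> m - K)" by (rule card_Un_le)
        finally have 1: "card (F j - K) \<le> card (F j - (Z \<inter> m)) + card (Z \<inter> m - K)" .
        have 2: "card (F k - L) \<le> card (F k - (Z \<union> m))" using L(2) fin by (intro card_mono) auto
        \<comment> \<open>Both pairs are compared through union and intersection;
          \<open>F j \<subseteq> F k\<close> puts an element of \<open>F j\<close> in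
          \<open>m\<close> but not in \<open>Z\<close> into \<open>F k - Z\<close>.\<close>
        have "card (F j - (Z \<inter> m)) + card (F k - (Z \<union> m)) \<le> card (F j - m) + card (F k - Z)"
        proof -
          have "card (F j - (Z \<inter> m)) + card (F k - (Z \<union> m))
            = card ((F j - (Z \<inter> m)) \<union> (F k - (Z \<union> m))) + card ((F j - (Z \<inter> m)) \<inter> (F k - (Z \<union> m)))"
            using fin by (intro card_Un_Int) auto
          also have "\<dots> \<le> card ((F j - m) \<union> (F k - Z)) + card ((F j - m) \<inter> (F k - Z))"
            using fin Fjk by (intro add_mono card_mono) auto
          also have "\<dots> = card (F j - m) + card (F k - Z)"
            using fin by (intro card_Un_Int[symmetric]) auto
          finally show ?thesis .
        qed
        then show ?thesis using 1 2 by linarith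
      qed
      \<comment> \<open>The upper bounds for \<open>m\<close> and \<open>Z\<close> add up to
        \<open>j + k\<close>; the lower bound \<open>k\<close> for \<open>L\<close> leaves at most
        \<open>j\<close> for \<open>K\<close>.\<close>
      then have "rk K + card (F j - K) \<le> j" using kL L(3) mj Zk by linarith
      then have "K \<in> W" using K(1) j W' by (auto simp: spanning_flats_def)
      moreover have "\<forall>Y\<in>W. Y \<subseteq> Z \<longrightarrow> Y \<subseteq> m \<longrightarrow> Y \<subseteq> K" using K(4) subsetD[OF WZ] by simp
      ultimately show ?thesis using K(2,3) by (intro bexI[of _ K] conjI)
    qed
    show ?thesis by (rule bexI[OF _ mW], rule ballI, rule conic)
  qed
qed

section \<open>The identity in a single coordinate\<close>

lemma chain_of_flats_sum:
  assumes lf: "loopfree E I" and rkE: "rk E = r"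
    and F: "F 0 = {}" "F r = E" "\<And>i. i < r \<Longrightarrow> F i \<subset> F (Suc i)"
  shows "(\<Sum>T\<in>cyclic_chains E I. - mobius (cyclic_chain_order E I) (Some T) None *
       of_bool (\<forall>i\<le>r. F i \<in> flats E (nested_matroid E I T)))
    = of_bool (\<forall>i\<le>r. F i \<in> flats E I)"
proof -
  obtain x where wc: "weighted_chain E r F x" using exists_weighted_chain[OF finite_ground F] by blast
  let ?Z = "cyclic_flats E I" and ?top = "top_cyclic_flat E I"
  let ?B = "bounded_chains ?Z {} ?top"
  let ?c = "chain_coeff ?Z {} ?top"
  have chains: "cyclic_chains E I = ?B"
    by (simp add: cyclic_chains_def bounded_chains_def)
  have nested: "(\<forall>i\<le>r. F i \<in> flats E (nested_matroid E I T)) \<longleftrightarrow>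
      T \<inter> violated x = {} \<and> (\<forall>i\<in>{..r}. T \<inter> spanning_flats F i \<noteq> {})" if T: "T \<in> cyclic_chains E I" for T
  proof -
    note N = nested_matroid[OF T]
    have TZ: "T \<subseteq> ?Z" using T by (simp add: cyclic_chains_def)
    \<comment> \<open>Independent sets of the original matroid stay independent, so no loops
      arise.\<close>
    have "loopfree E (nested_matroid E I T)" using lf N(4) by (auto simp: loopfree_def)
    then have "(\<forall>i\<le>r. F i \<in> flats E (nested_matroid E I T)) \<longleftrightarrow>
      (\<forall>Z\<in>T. sum x Z \<le> mat_rank (nested_matroid E I T) Z) \<and>
      (\<forall>i\<le>r. \<exists>Z\<in>T. mat_rank (nested_matroid E I T) Z + card (F i - Z) \<le> i)"
      using matroid.chain_of_flats_iff[OF N(1) wc] N(2,5) rkE by simp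
    also have "\<dots> \<longleftrightarrow> (\<forall>Z\<in>T. sum x Z \<le> rk Z) \<and> (\<forall>i\<le>r. \<exists>Z\<in>T. rk Z + card (F i - Z) \<le> i)"
      using N(3) by auto
    also have "\<dots> \<longleftrightarrow> T \<inter> violated x = {} \<and> (\<forall>i\<in>{..r}. T \<inter> spanning_flats F i \<noteq> {})"
    proof -
      have "T \<inter> violated x = {Z \<in> T. rk Z < sum x Z}"
        "T \<inter> spanning_flats F i = {Z \<in> T. rk Z + card (F i - Z) \<le> i}" for i
        using TZ by (auto simp: violated_def spanning_flats_def)
      then show ?thesis by (simp add: not_less Ball_def Bex_def)
    qed
    finally show ?thesis .
  qed
  have "(\<Sum>T\<in>cyclic_chains E I. - mobius (cyclic_chain_order E I) (Some T) None *
       of_bool (\<forall>i\<le>r. F i \<in> flats E (nested_matroid E I T)))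
    = (\<Sum>T\<in>?B. ?c T * of_bool (T \<inter> violated x = {} \<and> (\<forall>i\<in>{..r}. T \<inter> spanning_flats F i \<noteq> {})))"
  proof (rule sum.cong[OF chains])
    fix T assume "T \<in> ?B"
    then have T: "T \<in> cyclic_chains E I" by (simp only: chains)
    show "- mobius (cyclic_chain_order E I) (Some T) None *
       of_bool (\<forall>i\<le>r. F i \<in> flats E (nested_matroid E I T))
      = ?c T * of_bool (T \<inter> violated x = {} \<and> (\<forall>i\<in>{..r}. T \<inter> spanning_flats F i \<noteq> {}))"
      unfolding nested[OF T] mobius_cyclic_chain_order[OF matroid_axioms T] ..
  qed
  also have "\<dots> = (\<Sum>T | T \<in> ?B \<and> T \<inter> violated x = {} \<and> (\<forall>i\<in>{..r}. T \<inter> spanning_flats F i \<noteq> {}). ?c T)"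
    using finite_bounded_chains[OF finite_cyclic_flats]
    by (simp add: of_bool_def if_distrib[of "\<lambda>z. _ * z"] sum.If_cases Int_def cong: if_cong)
  also have "\<dots> = of_bool (violated x = {} \<and> (\<forall>i\<in>{..r}. spanning_flats F i \<noteq> {}))"
  proof (rule sum_avoiding_and_meeting)
    fix J assume J: "J \<subseteq> {..r}"
    let ?W = "violated x \<union> (\<Union>j\<in>J. spanning_flats F j)"
    show "(\<Sum>T | T \<in> ?B \<and> T \<inter> ?W = {}. ?c T) = of_bool (?W = {})"
    proof (rule sum_chain_coeff_avoiding_conic)
      show "{} \<in> ?Z" using lf empty_cyclic_flat_iff by simp
      show "?W \<subseteq> ?Z" by (auto simp: violated_def spanning_flats_def)
      show "\<exists>m\<in>?W. \<forall>Z\<in>?W. \<exists>K\<in>?W. K \<subseteq> Z \<and> K \<subseteq> m \<and> (\<forall>Y\<in>?W. Y \<subseteq> Z \<longrightarrow> Y \<subseteq> m \<longrightarrow> Y \<subseteq> K)"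
        if "?W \<noteq> {}" by (rule violated_spanning_conic[OF wc J refl that])
    qed (use finite_cyclic_flats top_cyclic_flat(1) cyclic_flat_subset_top in auto)
  qed (use finite_bounded_chains[OF finite_cyclic_flats] in auto)
  also have "(violated x = {} \<and> (\<forall>i\<in>{..r}. spanning_flats F i \<noteq> {})) \<longleftrightarrow> (\<forall>i\<le>r. F i \<in> flats E I)"
    unfolding chain_of_flats_iff[OF wc lf rkE]
    by (simp add: violated_def spanning_flats_def not_less Ball_def Bex_def)
  finally show ?thesis .
qed

end

section \<open>The matroid module\<close>

lemma group_hom_chain_map:
  "group_hom (free_Abelian_group (loopfree_matroids r n)) (chain_space r n) (chain_map r n)"
  using chain_map_hom[of r n] by (simp add: group_hom_def group_hom_axioms_def chain_space_def)

lemma chain_map_add: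
  assumes "Poly_Mapping.keys c \<subseteq> loopfree_matroids r n" "Poly_Mapping.keys d \<subseteq> loopfree_matroids r n"
    and "Fs \<in> full_chains r n"
  shows "chain_map r n (c + d) Fs = chain_map r n c Fs + chain_map r n d Fs"
proof -
  have "chain_map r n (c + d) = chain_map r n c \<otimes>\<^bsub>chain_space r n\<^esub> chain_map r n d"
    using hom_mult[OF chain_map_hom, of c r n d] assms(1,2) by simp
  then show ?thesis using assms(3) by (simp add: chain_space_def)
qed

lemma chain_map_frag_cmul_frag_of:
  "Fs \<in> full_chains r n \<Longrightarrow> chain_map r n (frag_cmul k (frag_of N)) Fs = k * chain_vector r n N Fs"
\<comment> \<open>For \<open>k = 0\<close> the support is empty instead of
  \<open>{N}\<close>.\<close>
proof (cases "k = 0")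
  case False
  then have "Poly_Mapping.keys (frag_cmul k (frag_of N)) = {N}"
    by (auto simp: in_keys_iff split: if_splits)
  then show "Fs \<in> full_chains r n \<Longrightarrow> ?thesis" by (simp add: chain_map_def)
qed (simp add: chain_map_def)

text \<open>Lifts an identity of chain vectors to the quotient: the formal combination and
  \<open>frag_of M\<close> have the same image under \<open>chain_map\<close>, so they differ by an
  element of the kernel.\<close>

lemma matroid_class_eq_finprod:
  assumes A: "finite A" and M: "M \<in> loopfree_matroids r n"
    and g: "\<And>T. T \<in> A \<Longrightarrow> g T \<in> loopfree_matroids r n"
    and eq: "\<And>Fs. Fs \<in> full_chains r n \<Longrightarrow> chain_vector r n M Fs = (\<Sum>T\<in>A. k T * chain_vector r n (g T) Fs)"
  shows "matroid_class r n M =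
    (\<Otimes>\<^bsub>matroid_module r n\<^esub>T\<in>A. matroid_class r n (g T) [^]\<^bsub>matroid_module r n\<^esub> (k T :: int))"
proof -
  let ?S = "loopfree_matroids r n"
  let ?G = "free_Abelian_group ?S" and ?Q = "matroid_module r n"
  let ?\<phi> = "\<lambda>c. chain_kernel r n #>\<^bsub>?G\<^esub> c"
  interpret h: group_hom ?G "chain_space r n" "chain_map r n" by (rule group_hom_chain_map)
  interpret N: normal "chain_kernel r n" ?G unfolding chain_kernel_def by (rule h.normal_kernel)
  interpret Q: comm_group ?Q by (rule comm_group_matroid_module)
  interpret \<phi>: group_hom ?G ?Q ?\<phi>
    using N.r_coset_hom_Mod by unfold_locales (simp add: matroid_module_def)
  let ?s = "\<lambda>B. \<Sum>T\<in>B. frag_cmul (k T) (frag_of (g T))"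
  have keys: "Poly_Mapping.keys (frag_cmul (k T) (frag_of (g T))) \<subseteq> ?S" if "T \<in> A" for T
    using g[OF that] keys_cmul[of "k T" "frag_of (g T)"] by auto
  \<comment> \<open>One induction carries membership in the free group, the class and the image of
    the partial sums, since the last two need the first.\<close>
  have s: "Poly_Mapping.keys (?s B) \<subseteq> ?S \<and>
      ?\<phi> (?s B) = (\<Otimes>\<^bsub>?Q\<^esub>T\<in>B. matroid_class r n (g T) [^]\<^bsub>?Q\<^esub> k T) \<and>
      (\<forall>Fs\<in>full_chains r n. chain_map r n (?s B) Fs = (\<Sum>T\<in>B. k T * chain_vector r n (g T) Fs))"
    if "B \<subseteq> A" for B
    using finite_subset[OF that A] that
  proof (induction B)
    case empty
    show ?case using \<phi>.hom_one by (simp add: chain_map_def)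
  next
    case (insert T B)
    let ?t = "frag_cmul (k T) (frag_of (g T))"
    have IH: "Poly_Mapping.keys (?s B) \<subseteq> ?S"
      "?\<phi> (?s B) = (\<Otimes>\<^bsub>?Q\<^esub>T\<in>B. matroid_class r n (g T) [^]\<^bsub>?Q\<^esub> k T)"
      "\<And>Fs. Fs \<in> full_chains r n \<Longrightarrow> chain_map r n (?s B) Fs = (\<Sum>T\<in>B. k T * chain_vector r n (g T) Fs)"
      using insert by auto
    have kt: "Poly_Mapping.keys ?t \<subseteq> ?S" using keys insert.prems by auto
    have sum: "?s (insert T B) = ?t + ?s B" using insert.hyps by simp
    have cl: "matroid_class r n (g U) \<in> carrier ?Q" if "U \<in> insert T B" for U
    proof -
      have "frag_of (g U) \<in> carrier ?G" using g[of U] insert.prems that by auto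
      then show ?thesis unfolding matroid_class_def by (rule \<phi>.hom_closed)
    qed
    have "?\<phi> ?t = matroid_class r n (g T) [^]\<^bsub>?Q\<^esub> k T"
    proof -
      have "frag_of (g T) \<in> carrier ?G" using g[of T] insert.prems by auto
      from \<phi>.hom_int_pow[OF this, of "k T"] show ?thesis
        using g[of T] insert.prems by (simp add: matroid_class_def)
    qed
    moreover have "?\<phi> (?t + ?s B) = ?\<phi> ?t \<otimes>\<^bsub>?Q\<^esub> ?\<phi> (?s B)"
      using \<phi>.hom_mult[of ?t "?s B"] kt IH(1) by simp
    ultimately have "?\<phi> (?s (insert T B)) = (\<Otimes>\<^bsub>?Q\<^esub>T\<in>insert T B. matroid_class r n (g T) [^]\<^bsub>?Q\<^esub> k T)"
      unfolding sum IH(2) using insert.hyps cl by (subst Q.finprod_insert) auto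
    moreover have "Poly_Mapping.keys (?s (insert T B)) \<subseteq> ?S"
      unfolding sum using kt IH(1) Poly_Mapping.keys_add[of ?t "?s B"] by blast
    moreover have "chain_map r n (?s (insert T B)) Fs = (\<Sum>T\<in>insert T B. k T * chain_vector r n (g T) Fs)"
      if "Fs \<in> full_chains r n" for Fs
      unfolding sum using insert.hyps that kt IH
      by (simp add: chain_map_add chain_map_frag_cmul_frag_of)
    ultimately show ?case by blast
  qed
  note sA = s[OF order_refl]
  have Mc: "frag_of M \<in> carrier ?G" and sc: "?s A \<in> carrier ?G" using M sA by auto
  have maps: "chain_map r n (frag_of M) = chain_map r n (?s A)"
  proof
    show "chain_map r n (frag_of M) Fs = chain_map r n (?s A) Fs" for Fs
    proof (cases "Fs \<in> full_chains r n")
      case True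
      then show ?thesis using sA eq chain_map_frag_of[OF M] by simp
    qed (simp add: chain_map_def)
  qed
  have "?s A - frag_of M \<in> chain_kernel r n"
  proof -
    have "?s A \<otimes>\<^bsub>?G\<^esub> inv\<^bsub>?G\<^esub> frag_of M \<in> kernel ?G (chain_space r n) (chain_map r n)"
      using Mc sc maps by (simp add: kernel_def del: mult_free_Abelian_group inv_free_Abelian_group carrier_free_Abelian_group_iff)
    then show ?thesis using M by (simp add: chain_kernel_def)
  qed
  then have "(?s A - frag_of M) \<otimes>\<^bsub>?G\<^esub> frag_of M \<in> ?\<phi> (frag_of M)"
    using Mc N.subset by (intro h.G.rcosI)
  then have "?s A \<in> ?\<phi> (frag_of M)" by simp
  then have "?\<phi> (frag_of M) = ?\<phi> (?s A)"
    using Mc N.subgroup_axioms by (rule h.G.repr_independence)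
  then show ?thesis using sA by (simp add: matroid_class_def)
qed

section \<open>Assembling the coordinates\<close>

theorem theorem3p12:
  fixes r n :: nat and M :: "nat set set"
  assumes "1 \<le> r" "r \<le> n"
    and "M \<in> loopfree_matroids r n"
  shows "matroid_class r n M =
    (\<Otimes>\<^bsub>matroid_module r n\<^esub>T\<in>cyclic_chains {1..n} M.
       matroid_class r n (nested_matroid {1..n} M T)
         [^]\<^bsub>matroid_module r n\<^esub> (- mobius (cyclic_chain_order {1..n} M) (Some T) None))"
proof (rule matroid_class_eq_finprod)
  let ?E = "{1..n}"
  have M: "matroid ?E M" and lf: "loopfree ?E M" and rkE: "mat_rank M ?E = r"
    using assms(3) by (auto simp: loopfree_matroids_def)
  interpret matroid ?E M by (rule M)
  show "finite (cyclic_chains ?E M)"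
    by (rule finite_subset[of _ "Pow (cyclic_flats ?E M)"]) (use finite_cyclic_flats in \<open>auto simp: cyclic_chains_def\<close>)
  show "M \<in> loopfree_matroids r n" by fact
  have nested_lf: "loopfree ?E (nested_matroid ?E M T)" if "T \<in> cyclic_chains ?E M" for T
    using lf nested_matroid(4)[OF that] by (auto simp: loopfree_def)
  show "nested_matroid ?E M T \<in> loopfree_matroids r n" if "T \<in> cyclic_chains ?E M" for T
    using nested_matroid(1,5)[OF that] nested_lf[OF that] rkE by (simp add: loopfree_matroids_def)
  fix Fs assume Fs: "Fs \<in> full_chains r n"
  \<comment> \<open>Prepending \<open>{}\<close> shifts the indices, so that \<open>F 0 = {}\<close>
    and \<open>F r\<close> is the last entry of \<open>Fs\<close>.\<close>
  define F where "F i = ({} # Fs) ! i" for i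
  have len: "length Fs = r" and sorted: "sorted_wrt (\<subset>) ({} # Fs)" and last: "last Fs = ?E"
    using Fs by (auto simp: full_chains_def)
  have F0: "F 0 = {}" by (simp add: F_def)
  have Fr: "F r = ?E"
  proof -
    have "Fs \<noteq> []" using len assms(1) by auto
    then have "F r = List.last Fs" using len assms(1) by (simp add: F_def last_conv_nth nth_Cons')
    then show ?thesis using last by simp
  qed
  have FS: "F i \<subset> F (Suc i)" if "i < r" for i
    unfolding F_def using sorted by (rule sorted_wrt_nth_less) (use that len in auto)
  \<comment> \<open>The additional member \<open>F 0 = {}\<close> is a flat because \<open>N\<close>
    is loopfree.\<close>
  have chain: "set Fs \<subseteq> flats ?E N \<longleftrightarrow> (\<forall>i\<le>r. F i \<in> flats ?E N)" if "matroid ?E N" "loopfree ?E N" for N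
  proof -
    have "{} \<in> flats ?E N" using that matroid.empty_flat_iff by blast
    then have "set Fs \<subseteq> flats ?E N \<longleftrightarrow> (\<forall>X\<in>set ({} # Fs). X \<in> flats ?E N)" by auto
    also have "\<dots> \<longleftrightarrow> (\<forall>i\<le>r. F i \<in> flats ?E N)"
      unfolding all_set_conv_all_nth F_def using len by (simp add: less_Suc_eq_le)
    finally show ?thesis .
  qed
  have "chain_vector r n M Fs = of_bool (\<forall>i\<le>r. F i \<in> flats ?E M)"
    using Fs chain[OF M lf] by (simp add: chain_vector_def)
  also have "\<dots> = (\<Sum>T\<in>cyclic_chains ?E M. - mobius (cyclic_chain_order ?E M) (Some T) None *
       of_bool (\<forall>i\<le>r. F i \<in> flats ?E (nested_matroid ?E M T)))"
    by (rule chain_of_flats_sum[OF lf rkE F0 Fr FS, symmetric])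
  also have "\<dots> = (\<Sum>T\<in>cyclic_chains ?E M. - mobius (cyclic_chain_order ?E M) (Some T) None *
       chain_vector r n (nested_matroid ?E M T) Fs)"
  proof (rule sum.cong[OF refl])
    fix T assume T: "T \<in> cyclic_chains ?E M"
    show "- mobius (cyclic_chain_order ?E M) (Some T) None *
       of_bool (\<forall>i\<le>r. F i \<in> flats ?E (nested_matroid ?E M T)) =
      - mobius (cyclic_chain_order ?E M) (Some T) None * chain_vector r n (nested_matroid ?E M T) Fs"
      using Fs chain[OF nested_matroid(1)[OF T] nested_lf[OF T]] by (simp add: chain_vector_def)
  qed
  finally show "chain_vector r n M Fs = (\<Sum>T\<in>cyclic_chains ?E M. - mobius (cyclic_chain_order ?E M) (Some T) None *
       chain_vector r n (nested_matroid ?E M T) Fs)" .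
qed

end
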